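(* Let $p$ be an odd prime and let $e$ be a positive divisor of $p-1$ such that $f=(p-1)/e$ is of the form $2^r$ with $r\ge 1$. Let $g$ be a primitive root modulo $p^2$, let $n\ge 1$ be an integer, and for $j\ge 1$ let $d_j=\varphi(p^j)/e=p^{j-1}f$, $$D_0^{(p^j)}=\{g^{d_j t}\bmod p^j:0\le t<e\},\qquad D_i^{(p^j)}=\{g^i x\bmod p^j: x\in D_0^{(p^j)}\},\ i=0,1,\dots,d_j-1 .$$ Let $b$ be an integer with $0\le b\le p^{n-1}f-1$ and put $$\mathcal{C}_1^{(p^n)}=\bigcup_{j=1}^{n}\bigcup_{i=0}^{d_j/2-1}p^{n-j}D^{(p^j)}_{(i+b)\bmod d_j}\ \cup\{0\}\subseteq \mathbb{Z}_{p^n}.$$ Let $s^\infty=(s_0,s_1,\dots)$ be the binary sequence of period $p^n$ with $s_i=1$ if $i\bmod p^n\in\mathcal{C}_1^{(p^n)}$ and $s_i=0$ otherwise. If $2^{p-1}\not\equiv 1\pmod{p^2}$, then the linear complexity $L$ of $s^\infty$ over $\mathbb{F}_2$ is $$L=\begin{cases} p^n-\frac{p-1}{2}-\delta\!\left(\frac{p^n+1}{2}\right), & \text{if } 2\in D_0^{(p)},\\[2pt] p^n-\delta\!\left(\frac{p^n+1}{2}\right), & \text{if } 2\notin D_0^{(p)},\end{cases}$$ where $\delta(t)=1$ if $t$ is even and $\delta(t)=0$ if $t$ is odd.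
   Context: $\varphi$ is Euler's totient function; $x\bmod N$ denotes the least nonnegative residue of $x$ modulo $N$. A primitive root modulo $p^2$ is also a primitive root modulo $p^j$ for all $j\ge1$. The linear complexity of a binary sequence of period $N$ is the length of the shortest linear feedback shift register generating it; equivalently $L=N-\deg\gcd(x^N-1,S(x))$ over $\mathbb{F}_2$, where $S(x)=s_0+s_1x+\dots+s_{N-1}x^{N-1}$. The condition "$2\in D_0^{(p)}$" means that $2\bmod p$ belongs to $D_0^{(p)}$. *)

theory Defs
  imports "HOL-Number_Theory.Number_Theory" "HOL-Library.Z2"
begin

definition cyc_order :: "nat \<Rightarrow> nat \<Rightarrow> nat \<Rightarrow> nat" where
  "cyc_order p e j = totient (p ^ j) div e"

definition cyc_class0 :: "nat \<Rightarrow> nat \<Rightarrow> nat \<Rightarrow> nat \<Rightarrow> nat set" where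
  "cyc_class0 p e g j = (\<lambda>t. g ^ (cyc_order p e j * t) mod p ^ j) ` {0..<e}"

definition cyc_class :: "nat \<Rightarrow> nat \<Rightarrow> nat \<Rightarrow> nat \<Rightarrow> nat \<Rightarrow> nat set" where
  "cyc_class p e g j i = (\<lambda>x. g ^ i * x mod p ^ j) ` cyc_class0 p e g j"

(* The ring of integers modulo p^n is represented by the least residues 0, ..., p^n - 1.
   Elements of cyc_class p e g j i are below p^j, so multiplying them by p^(n-j)
   needs no further reduction. *)
definition support_set :: "nat \<Rightarrow> nat \<Rightarrow> nat \<Rightarrow> nat \<Rightarrow> nat \<Rightarrow> nat set" where
  "support_set p e g n b =
     (\<Union>j\<in>{1..n}. \<Union>i\<in>{0..<cyc_order p e j div 2}.
        (\<lambda>x. p ^ (n - j) * x) ` cyc_class p e g j ((i + b) mod cyc_order p e j)) \<union> {0}"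

(* The type bit is the two-element field. *)
definition cyc_seq :: "nat \<Rightarrow> nat \<Rightarrow> nat \<Rightarrow> nat \<Rightarrow> nat \<Rightarrow> nat \<Rightarrow> bit" where
  "cyc_seq p e g n b i = (if i mod p ^ n \<in> support_set p e g n b then 1 else 0)"

(* A linear feedback shift register of length L with feedback coefficients c(0), ..., c(L-1),
   loaded with s(0), ..., s(L-1), outputs s. For L = 0 the output is the zero sequence. *)
definition lfsr_generates :: "nat \<Rightarrow> (nat \<Rightarrow> 'a) \<Rightarrow> (nat \<Rightarrow> 'a :: field) \<Rightarrow> bool" where
  "lfsr_generates L c s \<longleftrightarrow> (\<forall>i. s (i + L) = (\<Sum>k<L. c k * s (i + k)))"

(* Meaningful for (ultimately) periodic sequences, which some register always generates. *)
definition linear_complexity :: "(nat \<Rightarrow> 'a :: field) \<Rightarrow> nat" where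
  "linear_complexity s = (LEAST L. \<exists>c. lfsr_generates L c s)"

definition even_indicator :: "nat \<Rightarrow> int" where
  "even_indicator t = (if even t then 1 else 0)"

end

theory Submission
  imports "HOL-Algebra.Algebraic_Closure_Type" Defs
begin

text \<open>
  The linear complexity of a sequence \<open>s\<close> of odd period \<open>N\<close> is the number of
  nonzero values \<open>S(\<gamma>\<^sup>a)\<close>, \<open>0 \<le> a < N\<close>, where \<open>\<gamma>\<close> is a primitive \<open>N\<close>-th root of unity in an
  algebraic closure. So one counts the zeros of \<open>S\<close> among the roots of unity \<open>z\<close> of order
  \<open>p\<^sup>m\<close>, \<open>0 \<le> m \<le> n\<close>.

  The generalized cyclotomic sets are compatible with reduction: every nonzero residue modulo
  \<open>p\<^sup>j\<close> has \<open>(p - 1)/2\<close> or \<open>(p + 1)/2\<close> of its \<open>p\<close> lifts in the support, the larger number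
  exactly when it is in the support itself. So for \<open>z \<noteq> 1\<close> of order \<open>p\<^sup>m\<close> the value \<open>S(z)\<close> is
  that of the sequence of period \<open>p\<^sup>m\<close>, and \<open>S(1) = (p\<^sup>n + 1)/2\<close>.

  For \<open>m \<ge> 2\<close> there is no zero. Since \<open>2\<close> generates all residues congruent to \<open>1\<close> modulo \<open>p\<close>
  (this is the Wieferich hypothesis), a zero \<open>z\<close> would bring the zeros \<open>z\<^sup>c\<close> for all
  \<open>c \<equiv> 1\<close> modulo \<open>p\<close>. By Fourier inversion over these, the part of \<open>S\<close> supported on a single
  residue class modulo \<open>p\<^bsup>m-1\<^esup>\<close> vanishes at \<open>z\<close>; but that part is a geometric sum with
  \<open>(p \<plusminus> 1)/2\<close> terms.

  For \<open>m = 1\<close>, \<open>S(z) + S(z\<^sup>h) = 1\<close> for \<open>h = g\<^bsup>f/2\<^esup>\<close>, because multiplication by \<open>h\<close> exchanges the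
  support with its complement. If \<open>2 \<in> D\<^sub>0\<close>, then \<open>S(z)\<^sup>2 = S(z\<^sup>2) = S(z)\<close>, so \<open>S(z)\<close> is \<open>0\<close> or \<open>1\<close>
  and half of the values vanish. Otherwise, \<open>f\<close> being a power of two, some power of \<open>2\<close> lies in
  \<open>h D\<^sub>0\<close>, so \<open>S(z) = 0\<close> would imply \<open>S(z\<^sup>h) = 0\<close>.
\<close>

subsection \<open>Powers of units congruent to one\<close>

text \<open>The binomial theorem cut after the quadratic term. The quadratic coefficient is kept
  explicit because for \<open>k = p\<close> it supplies a factor \<open>p\<close>.\<close>

lemma one_plus_power_expand:
  fixes y k :: nat
  shows "\<exists>q. (1 + y) ^ k = 1 + k * y + (k choose 2) * y ^ 2 + q * y ^ 3"
proof (induction k)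
  case (Suc k)
  then obtain q where q: "(1 + y) ^ k = 1 + k * y + (k choose 2) * y ^ 2 + q * y ^ 3"
    by blast
  have "Suc k choose 2 = (k choose 2) + k"
    by (simp add: numeral_2_eq_2)
  then have "(1 + y) ^ Suc k =
      1 + Suc k * y + (Suc k choose 2) * y ^ 2 + (q + (k choose 2) + q * y) * y ^ 3"
    unfolding power_Suc q by (simp add: algebra_simps power2_eq_square power3_eq_cube)
  then show ?case by blast
qed auto

text \<open>Beyond the linear term every term contains \<open>(p ^ j)\<^sup>2\<close>, and
  \<open>2 * j \<ge> j + 1\<close>.\<close>

lemma cong_one_plus_power:
  fixes p w :: nat
  assumes "j \<ge> 1"
  shows "[(1 + p ^ j * w) ^ k = 1 + p ^ j * w * k] (mod p ^ Suc j)"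
proof -
  obtain q where q: "(1 + p ^ j * w) ^ k =
      1 + k * (p ^ j * w) + (k choose 2) * (p ^ j * w) ^ 2 + q * (p ^ j * w) ^ 3"
    using one_plus_power_expand by blast
  have "p ^ Suc j dvd (p ^ j) ^ 2"
    using assms by (simp add: le_imp_power_dvd flip: power_mult power_Suc)
  moreover have "(p ^ j) ^ 2 dvd (k choose 2) * (p ^ j * w) ^ 2 + q * (p ^ j * w) ^ 3"
    by (simp add: power_mult_distrib power2_eq_square power3_eq_cube)
  ultimately have "[(k choose 2) * (p ^ j * w) ^ 2 + q * (p ^ j * w) ^ 3 = 0] (mod p ^ Suc j)"
    using dvd_trans unfolding cong_0_iff by blast
  from cong_add[OF cong_refl[of "1 + p ^ j * w * k"] this] show ?thesis
    unfolding q by (simp add: algebra_simps)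
qed

text \<open>For odd \<open>p\<close> the quadratic coefficient \<open>p * (p - 1) / 2\<close> is
  divisible by \<open>p\<close>. Hence the quadratic and cubic terms vanish modulo
  \<open>p ^ (j + 2)\<close>, even for \<open>j = 1\<close>, and \<open>w'\<close> is congruent to
  \<open>w\<close> modulo \<open>p\<close>.\<close>

lemma one_plus_prime_power_lift:
  fixes p w :: nat
  assumes "odd p" "j \<ge> 1" "\<not> p dvd w"
  shows "\<exists>w'. (1 + p ^ j * w) ^ p = 1 + p ^ Suc j * w' \<and> \<not> p dvd w'"
proof -
  obtain q where q: "(1 + p ^ j * w) ^ p =
      1 + p * (p ^ j * w) + (p choose 2) * (p ^ j * w) ^ 2 + q * (p ^ j * w) ^ 3"
    using one_plus_power_expand by blast
  obtain i where j: "j = Suc i" using assms(2) by (cases j) auto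
  obtain h where h: "p = 2 * h + 1" using assms(1) by (auto elim: oddE)
  have c2: "p choose 2 = p * h"
    by (simp add: choose_two h)
  define P where "P = p ^ i"
  define v where "v = h * P * w ^ 2 + q * P * P * w ^ 3"
  have "1 + p * (p * P * w) + p * h * (p * P * w) ^ 2 + q * (p * P * w) ^ 3
      = 1 + p * (p * P) * (w + p * v)"
    unfolding v_def by (simp add: algebra_simps power2_eq_square power3_eq_cube)
  then have "(1 + p ^ j * w) ^ p = 1 + p ^ Suc j * (w + p * v)"
    unfolding q c2 by (simp add: j P_def)
  moreover have "\<not> p dvd w + p * v"
    using assms(3) by (simp add: dvd_add_left_iff)
  ultimately show ?thesis by blast
qed

lemma one_plus_prime_power_iterate:
  fixes p w :: nat
  assumes "odd p" "\<not> p dvd w"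
  shows "\<exists>w'. (1 + p * w) ^ (p ^ m) = 1 + p ^ Suc m * w' \<and> \<not> p dvd w'"
proof (induction m)
  case 0
  show ?case using assms(2) by (intro exI[of _ w]) simp
next
  case (Suc m)
  then obtain w' where w': "(1 + p * w) ^ (p ^ m) = 1 + p ^ Suc m * w'" "\<not> p dvd w'"
    by blast
  have "(1 + p * w) ^ (p ^ Suc m) = ((1 + p * w) ^ (p ^ m)) ^ p"
    by (simp only: power_mult[symmetric] power_Suc2)
  also have "\<dots> = (1 + p ^ Suc m * w') ^ p"
    by (simp only: w'(1))
  finally have "(1 + p * w) ^ (p ^ Suc m) = (1 + p ^ Suc m * w') ^ p" .
  then show ?case
    using one_plus_prime_power_lift[OF assms(1) _ w'(2), of "Suc m"] by (simp only:)
qed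

lemma solve_linear_cong:
  fixes a c p :: nat
  assumes "prime p" "\<not> p dvd a"
  shows "\<exists>t. [a * t = c] (mod p)"
proof -
  have "coprime p a" using assms by (rule prime_imp_coprime)
  then have "coprime a p" by (rule coprime_commute[THEN iffD1])
  then obtain t where t: "[a * t = Suc 0] (mod p)" using cong_solve_coprime_nat by metis
  have "[a * (t * c) = c] (mod p)"
    using cong_scalar_right[OF t, of c] by (simp add: mult.assoc)
  then show ?thesis ..
qed

text \<open>Hensel-style lifting of the exponent: once \<open>k\<close> is right modulo
  \<open>p ^ m\<close>, adding multiples of \<open>p ^ (m - 1)\<close> to it runs through all lifts
  modulo \<open>p ^ Suc m\<close>. It is applied to \<open>1 + p * w = 2 ^ (p - 1)\<close>.\<close>

lemma one_units_generated:
  fixes p w c :: nat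
  assumes "prime p" "odd p" "\<not> p dvd w" "[c = 1] (mod p)"
  shows "\<exists>k. [(1 + p * w) ^ k = c] (mod p ^ m)"
proof (induction m)
  case (Suc m)
  let ?A = "1 + p * w"
  show ?case
  proof (cases "m = 0")
    case True
    then show ?thesis using assms(4) cong_sym by (intro exI[of _ 0]) auto
  next
    case False
    obtain k where k: "[?A ^ k = c] (mod p ^ m)" using Suc by blast
    obtain m' where m': "m = Suc m'" using False by (cases m) auto
    obtain w' where w': "?A ^ (p ^ m') = 1 + p ^ m * w'" "\<not> p dvd w'"
      using one_plus_prime_power_iterate[OF assms(2,3)] m' by blast
    have A1: "[?A ^ k = 1] (mod p)"
    proof -
      have "[1 + p * w = 1 + 0] (mod p)" by (intro cong_add cong_refl) (simp add: cong_0_iff)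
      from cong_pow[OF this, of k] show ?thesis by simp
    qed
    \<comment> \<open>The error is signed, since \<open>c\<close> may be smaller than
      \<open>?A ^ k\<close>; hence the passage to integers.\<close>
    obtain u where u: "int c = int (?A ^ k) + int (p ^ m) * u"
      using k unfolding cong_iff_lin cong_int_iff[symmetric] by metis
    \<comment> \<open>The correction factor is \<open>1 + p ^ m * w' * t\<close>. As
      \<open>?A ^ k\<close> is \<open>1\<close> modulo \<open>p\<close>, it cancels the error when
      \<open>w' * t\<close> is \<open>u\<close> modulo \<open>p\<close>.\<close>
    obtain t where t: "[w' * t = nat (u mod int p)] (mod p)"
      using solve_linear_cong[OF assms(1) w'(2)] by blast
    have "int (nat (u mod int p)) = u mod int p"
      using assms(1) by (simp add: prime_gt_0_nat)
    then have tu: "[int (w' * t) = u] (mod int p)"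
      using t unfolding cong_int_iff[symmetric] by (simp add: cong_def)
    have "[?A ^ (k + p ^ m' * t) = ?A ^ k * (1 + p ^ m * w' * t)] (mod p ^ Suc m)"
      unfolding power_add power_mult w'(1)
      using False by (intro cong_mult cong_refl cong_one_plus_power) auto
    moreover have "[int (?A ^ k * (1 + p ^ m * w' * t)) = int c] (mod int (p ^ Suc m))"
    proof -
      have "[int (?A ^ k) * int (w' * t) = 1 * u] (mod int p)"
        using A1 tu unfolding cong_int_iff[symmetric] by (intro cong_mult) auto
      then have "int (p ^ m) * int p dvd int (p ^ m) * (int (?A ^ k) * int (w' * t) - u)"
        by (intro mult_dvd_mono) (simp_all add: cong_iff_dvd_diff)
      also have "int (p ^ m) * (int (?A ^ k) * int (w' * t) - u)
          = int (?A ^ k * (1 + p ^ m * w' * t)) - int c"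
        unfolding u by (simp add: algebra_simps)
      finally show ?thesis
        by (simp add: cong_iff_dvd_diff mult.commute)
    qed
    ultimately show ?thesis
      using cong_trans unfolding cong_int_iff by blast
  qed
qed auto

section \<open>Sums of periodic functions over residue classes\<close>

lemma sum_periodic_affine:
  fixes h :: "nat \<Rightarrow> 'a :: comm_monoid_add"
  assumes "p > 0" "coprime c p" "\<And>t. h (t mod p) = h t"
  shows "(\<Sum>t<p. h (a + c * t)) = (\<Sum>t<p. h t)"
proof -
  let ?\<pi> = "\<lambda>t. (a + c * t) mod p"
  have inj: "inj_on ?\<pi> {..<p}"
  proof (rule inj_onI)
    fix x y assume xy: "x \<in> {..<p}" "y \<in> {..<p}" "?\<pi> x = ?\<pi> y"
    then have "[c * x = c * y] (mod p)"
      using cong_add_lcancel_nat unfolding cong_def[symmetric] by blast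
    then have "[x = y] (mod p)"
      using assms(2) cong_mult_lcancel_nat by blast
    then show "x = y" using xy cong_less_modulus_unique_nat by auto
  qed
  have img: "?\<pi> ` {..<p} = {..<p}"
    using assms(1) inj by (intro endo_inj_surj) auto
  have "(\<Sum>t<p. h t) = (\<Sum>t<p. h (?\<pi> t))"
    using sum.reindex[OF inj, of h] unfolding img by simp
  then show ?thesis using assms(3) by simp
qed

lemma sum_lessThan_times:
  fixes h :: "nat \<Rightarrow> 'a :: comm_monoid_add"
  assumes "P > 0"
  shows "(\<Sum>i<P * p. h i) = (\<Sum>x<P. \<Sum>t<p. h (x + P * t))"
proof -
  have "(\<Sum>i<P * p. h i) = (\<Sum>(x, t)\<in>{..<P} \<times> {..<p}. h (x + P * t))"
  proof (rule sum.reindex_bij_witness[where i = "\<lambda>(x, t). x + P * t" and j = "\<lambda>i. (i mod P, i div P)"])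
    fix a assume "a \<in> {..<P} \<times> {..<p}"
    then obtain x t where a: "a = (x, t)" "x < P" "t < p" by auto
    have "x + P * t < P + P * t" using a by simp
    also have "\<dots> = P * Suc t" by simp
    also have "\<dots> \<le> P * p" using a by (intro mult_le_mono) auto
    finally show "(case a of (x, t) \<Rightarrow> x + P * t) \<in> {..<P * p}" using a by simp
  qed (auto simp: assms less_mult_imp_div_less mult.commute)
  then show ?thesis by (simp add: sum.cartesian_product)
qed

text \<open>The lifts of \<open>x\<close> may be listed from any representative \<open>x0\<close>
  and with any step \<open>c\<close> prime to \<open>p\<close>. This allows a listing in which the
  support becomes an initial segment.\<close>

lemma sum_residue_class_affine:
  fixes h :: "nat \<Rightarrow> 'a :: comm_monoid_add"
  assumes "P > 0" "p > 0" "coprime c p" "\<And>i. h (i mod (P * p)) = h i"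
    and "x < P" "[x0 = x] (mod P)"
  shows "(\<Sum>t<p. h (x + P * t)) = (\<Sum>t<p. h (x0 + P * (c * t)))"
proof -
  define q where "q = x0 div P"
  have x0: "x0 = x + P * q"
    using assms(5,6) unfolding q_def cong_def by (metis mod_less mod_mult_div_eq)
  have "h (x + P * (t mod p)) = h (x + P * t)" for t
  proof -
    have "(x + P * (t mod p)) mod (P * p) = (x + P * t) mod (P * p)"
      by (metis mod_add_right_eq mult_mod_right)
    then show ?thesis using assms(4) by metis
  qed
  from sum_periodic_affine[OF assms(2,3), of "\<lambda>t. h (x + P * t)" q, OF this]
  show ?thesis unfolding x0 by (simp add: algebra_simps)
qed

subsection \<open>Linear complexity and the discrete Fourier transform\<close>

lemma of_nat_odd_char2:
  assumes "(2 :: 'k :: ring_1) = 0" "odd N"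
  shows "(of_nat N :: 'k) = 1"
  using assms by (auto elim!: oddE)

lemma sum_powers_root_unity:
  fixes w :: "'k :: field"
  assumes "(2 :: 'k) = 0" "odd N" "w ^ N = 1"
  shows "(\<Sum>a<N. w ^ a) = of_bool (w = 1)"
  using assms geometric_sum[of w N] of_nat_odd_char2[OF assms(1,2)] by (cases "w = 1") auto

lemma power2_sum_char2:
  fixes h :: "'a \<Rightarrow> 'k :: comm_ring_1"
  assumes "(2 :: 'k) = 0"
  shows "(\<Sum>x\<in>A. h x) ^ 2 = (\<Sum>x\<in>A. h x ^ 2)"
  by (induction A rule: infinite_finite_induct) (auto simp: power2_sum assms)

text \<open>The embedding of the prime field into a field of characteristic two.\<close>

abbreviation bit_embed :: "bit \<Rightarrow> 'k :: field" where
  "bit_embed x \<equiv> of_bool (x = 1)"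

lemma bit_embed_mult: "bit_embed (x * y) = (bit_embed x * bit_embed y :: 'k :: field)"
  by (cases x; cases y) auto

lemma bit_embed_sum:
  assumes "(2 :: 'k :: field) = 0"
  shows "bit_embed (\<Sum>x\<in>A. h x) = (\<Sum>x\<in>A. bit_embed (h x) :: 'k)"
proof (induction A rule: infinite_finite_induct)
  case (insert a A)
  have "bit_embed (x + y) = (bit_embed x + bit_embed y :: 'k)" for x y
    using assms by (cases x; cases y) auto
  with insert show ?case by simp
qed auto

lemma bit_embed_inject:
  "(bit_embed x :: 'k :: field) = bit_embed y \<longleftrightarrow> x = y"
  by (cases x; cases y) auto

text \<open>Blahut's theorem. Fourier inversion writes \<open>s\<close> as a combination of
  geometric sequences, one for each nonzero transform value. A recurrence holds for \<open>s\<close>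
  exactly if its characteristic polynomial vanishes at all their ratios, so the least length is the
  number of ratios.\<close>

lemma linear_complexity_eq_card_dft:
  fixes s :: "nat \<Rightarrow> bit" and \<gamma> :: "'k :: field"
  assumes char2: "(2 :: 'k) = 0" and "odd N" and per: "\<And>i. s (i mod N) = s i"
    and ord: "\<And>k. \<gamma> ^ k = 1 \<longleftrightarrow> N dvd k"
  shows "linear_complexity s =
    card {a. a < N \<and> (\<Sum>i<N. bit_embed (s i) * \<gamma> ^ (a * i)) \<noteq> 0}"
proof -
  have "N > 0" using \<open>odd N\<close> by (cases N) auto
  define \<beta> where "\<beta> = inverse \<gamma>"
  define A where "A a = (\<Sum>i<N. bit_embed (s i) * \<gamma> ^ (a * i))" for a
  define W where "W = {a. a < N \<and> A a \<noteq> 0}"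
  have finW: "finite W" unfolding W_def by simp
  have \<gamma>N: "\<gamma> ^ N = 1" using ord by simp
  have nz: "\<gamma> \<noteq> 0" using \<gamma>N \<open>N > 0\<close> by (auto simp: zero_power)
  have \<beta>\<gamma>: "\<gamma> ^ k * \<beta> ^ k = 1" for k
    using nz by (simp add: \<beta>_def flip: power_mult_distrib)
  have \<beta>N: "\<beta> ^ N = 1" using \<beta>\<gamma>[of N] \<gamma>N by simp
  have eq_iff: "\<gamma> ^ i * \<beta> ^ j = 1 \<longleftrightarrow> [i = j] (mod N)" for i j
  proof -
    have *: "\<gamma> ^ i * \<beta> ^ j = 1 \<longleftrightarrow> [i = j] (mod N)" if "j \<le> i" for i j
    proof -
      have "\<gamma> ^ i * \<beta> ^ j = \<gamma> ^ (i - j) * (\<gamma> ^ j * \<beta> ^ j)"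
        using that by (simp flip: power_add mult.assoc)
      then show ?thesis
        using that ord by (simp add: \<beta>\<gamma> cong_altdef_nat)
    qed
    show ?thesis
    proof (cases "j \<le> i")
      case False
      have "\<gamma> ^ i * \<beta> ^ j = inverse (\<gamma> ^ j * \<beta> ^ i)"
        unfolding \<beta>_def by (simp add: power_inverse)
      then show ?thesis using *[of i j] False
        by (metis cong_sym inverse_1 inverse_eq_1_iff nle_le)
    qed (rule *)
  qed
  have \<beta>_inj: "inj_on (\<lambda>a. \<beta> ^ a) {..<N}"
  proof (rule inj_onI)
    fix x y assume xy: "x \<in> {..<N}" "y \<in> {..<N}" "\<beta> ^ x = \<beta> ^ y"
    then have "[x = y] (mod N)" using eq_iff[of x y] \<beta>\<gamma>[of x] by simp
    then show "x = y" using xy cong_less_modulus_unique_nat by auto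
  qed
  \<comment> \<open>No factor \<open>1 / N\<close> arises in the inversion, because the odd number
    \<open>N\<close> equals \<open>1\<close> in characteristic two.\<close>
  have orth: "(\<Sum>a<N. (\<gamma> ^ j * \<beta> ^ i) ^ a) = of_bool ([j = i] (mod N))" for i j
    unfolding eq_iff[symmetric]
    by (intro sum_powers_root_unity assms)
       (simp add: power_mult_distrib \<gamma>N \<beta>N mult.commute[of _ N] flip: power_mult,
        simp add: power_mult \<gamma>N \<beta>N)
  have inv: "bit_embed (s i) = (\<Sum>a<N. A a * \<beta> ^ (a * i))" for i
  proof -
    have "(\<Sum>a<N. A a * \<beta> ^ (a * i)) =
        (\<Sum>j<N. \<Sum>a<N. bit_embed (s j) * (\<gamma> ^ j * \<beta> ^ i) ^ a)"
      unfolding A_def sum_distrib_right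
      by (subst sum.swap) (simp add: power_mult_distrib power_mult[symmetric] mult_ac)
    also have "\<dots> = (\<Sum>j<N. bit_embed (s j) * of_bool ([j = i] (mod N)))"
      by (simp add: orth flip: sum_distrib_left)
    also have "\<dots> = (\<Sum>j<N. if j = i mod N then bit_embed (s j) else 0)"
      by (intro sum.cong) (auto simp: cong_def)
    also have "\<dots> = bit_embed (s i)"
      using \<open>N > 0\<close> per[of i] by simp
    finally show ?thesis by simp
  qed
  have combine: "(\<Sum>k\<in>I. c k * bit_embed (s (i + k))) =
      (\<Sum>a<N. A a * \<beta> ^ (a * i) * (\<Sum>k\<in>I. c k * (\<beta> ^ a) ^ k))" for c and I :: "nat set" and i
    unfolding inv sum_distrib_left
    by (subst sum.swap) (simp add: power_add power_mult[symmetric] algebra_simps)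
  \<comment> \<open>Coefficients are allowed in the large field. The forward direction is the linear
    independence of the geometric sequences, obtained by transforming the recurrence once
    more.\<close>
  have annihilate: "(\<forall>i. (\<Sum>k\<in>I. c k * bit_embed (s (i + k))) = 0) \<longleftrightarrow>
      (\<forall>a\<in>W. (\<Sum>k\<in>I. c k * (\<beta> ^ a) ^ k) = 0)" (is "?l \<longleftrightarrow> ?r")
    for c and I :: "nat set"
  proof
    assume ?r
    then have "A a * \<beta> ^ (a * i) * (\<Sum>k\<in>I. c k * (\<beta> ^ a) ^ k) = 0" if "a < N" for a i
      using that unfolding W_def by (cases "A a = 0") auto
    then show ?l unfolding combine by (intro allI sum.neutral ballI) (simp only: lessThan_iff)
  next
    assume l: ?l
    show ?r
    proof
      fix a assume "a \<in> W"
      let ?P = "\<lambda>a. \<Sum>k\<in>I. c k * (\<beta> ^ a) ^ k"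
      have "0 = (\<Sum>i<N. \<gamma> ^ (a * i) * (\<Sum>k\<in>I. c k * bit_embed (s (i + k))))"
        using l by simp
      also have "\<dots> = (\<Sum>a'<N. \<Sum>i<N. A a' * ?P a' * (\<gamma> ^ a * \<beta> ^ a') ^ i)"
        unfolding combine sum_distrib_left
        by (subst sum.swap)
           (simp add: power_mult_distrib power_mult[symmetric] mult_ac sum_distrib_left sum_distrib_right)
      also have "\<dots> = (\<Sum>a'<N. A a' * ?P a' * of_bool ([a = a'] (mod N)))"
        by (simp add: orth flip: sum_distrib_left)
      also have "\<dots> = (\<Sum>a'<N. if a' = a then A a' * ?P a' else 0)"
        using \<open>a \<in> W\<close> unfolding W_def by (intro sum.cong) (auto simp: cong_def)
      also have "\<dots> = A a * ?P a" using \<open>a \<in> W\<close> unfolding W_def by simp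
      finally show "?P a = 0" using \<open>a \<in> W\<close> unfolding W_def by simp
    qed
  qed
  have cardW: "card ((\<lambda>a. \<beta> ^ a) ` W) = card W"
    by (rule card_image, rule inj_on_subset[OF \<beta>_inj]) (auto simp: W_def)

  have lower: "card W \<le> L" if "lfsr_generates L c s" for L c
  proof -
    \<comment> \<open>The coefficient \<open>-1\<close> moves the output term into the sum and makes
      the polynomial \<open>P\<close> nonzero, so its number of roots is at most
      \<open>L\<close>.\<close>
    define c' :: "nat \<Rightarrow> 'k" where "c' k = (if k = L then -1 else bit_embed (c k))" for k
    define P where "P = (\<Sum>k\<le>L. monom (c' k) k)"
    have polyP: "poly P x = (\<Sum>k\<le>L. c' k * x ^ k)" for x
      by (simp add: P_def poly_sum poly_monom)
    have coeffP: "coeff P k = (if k \<le> L then c' k else 0)" for k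
      by (simp add: P_def coeff_sum)
    have "bit_embed (s (i + L)) = (\<Sum>k<L. bit_embed (c k) * (bit_embed (s (i + k)) :: 'k))" for i
      using that unfolding lfsr_generates_def
      by (simp only: bit_embed_sum[OF char2] bit_embed_mult)
    then have "(\<Sum>k\<le>L. c' k * bit_embed (s (i + k))) = 0" for i
      by (simp add: c'_def lessThan_Suc_atMost[symmetric])
    then have "\<forall>a\<in>W. poly P (\<beta> ^ a) = 0"
      unfolding polyP annihilate[symmetric] by simp
    then have "(\<lambda>a. \<beta> ^ a) ` W \<subseteq> {x. poly P x = 0}" by auto
    moreover have "P \<noteq> 0"
    proof
      assume "P = 0"
      then have "coeff P L = 0" by simp
      then show False unfolding coeffP by (simp add: c'_def)
    qed
    ultimately have "card W \<le> card {x. poly P x = 0}"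
      using card_mono poly_roots_finite cardW by metis
    also have "\<dots> \<le> degree P" using \<open>P \<noteq> 0\<close> by (rule card_poly_roots_bound)
    also have "\<dots> \<le> L" by (rule degree_le) (simp add: coeffP)
    finally show ?thesis .
  qed

  \<comment> \<open>The characteristic polynomial of the shortest recurrence over the large field;
    it remains to find its coefficients in the two-element field.\<close>
  define M where "M = (\<Prod>a\<in>W. [:- (\<beta> ^ a), 1:])"
  define Q where "Q = map_poly (\<lambda>x. x ^ 2) M"
  define V where "V = card W"
  have degM: "degree M = V"
    unfolding M_def V_def by (subst degree_prod_eq_sum_degree) auto
  have leadM: "coeff M V = 1"
    using lead_coeff_prod[of "\<lambda>a. [:- (\<beta> ^ a), 1:]" W] degM unfolding M_def by simp
  have coeffQ: "coeff Q k = coeff M k ^ 2" for k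
    unfolding Q_def by (rule coeff_map_poly) simp
  have degQ: "degree Q \<le> V"
    unfolding Q_def using map_poly_degree_leq[of _ M] degM by metis
  have rootM: "poly M (\<beta> ^ a) = 0" if "a \<in> W" for a
    unfolding M_def poly_prod using that finW by auto
  have annM: "(\<Sum>k\<le>V. coeff M k * bit_embed (s (i + k))) = 0" for i
    using rootM annihilate[where I = "{..V}" and c = "coeff M"] unfolding poly_altdef degM by blast
  text \<open>Squaring the recurrence fixes the sequence, so by uniqueness of the minimal recurrence
    its coefficients are fixed by the Frobenius map, hence lie in the prime field.\<close>
  have annQ: "(\<Sum>k\<le>V. coeff Q k * bit_embed (s (i + k))) = 0" for i
  proof -
    have "(\<Sum>k\<le>V. coeff Q k * bit_embed (s (i + k))) =
        (\<Sum>k\<le>V. (coeff M k * bit_embed (s (i + k))) ^ 2)"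
      unfolding coeffQ by (intro sum.cong) auto
    also have "\<dots> = 0" by (simp only: power2_sum_char2[OF char2, symmetric] annM) simp
    finally show ?thesis .
  qed
  have rootQ: "poly Q (\<beta> ^ a) = 0" if "a \<in> W" for a
  proof -
    have "(\<Sum>k\<le>V. coeff Q k * (\<beta> ^ a) ^ k) = 0"
      using annQ that annihilate[where I = "{..V}" and c = "coeff Q"] by blast
    moreover have "poly Q (\<beta> ^ a) = (\<Sum>k\<le>V. coeff Q k * (\<beta> ^ a) ^ k)"
      unfolding poly_altdef using degQ
      by (intro sum.mono_neutral_left) (auto simp: coeff_eq_0)
    ultimately show ?thesis by simp
  qed
  \<comment> \<open>Both have degree at most \<open>V\<close> and the same coefficient at
    \<open>V\<close>, and they agree at \<open>V\<close> distinct points.\<close>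
  have "Q = M"
  proof (rule poly_eqI_degree_lead_coeff[where n = V and A = "(\<lambda>a. \<beta> ^ a) ` W"])
    show "coeff Q V = coeff M V" by (simp add: coeffQ leadM)
  qed (use rootM rootQ degM degQ cardW V_def in auto)
  then have "coeff M k ^ 2 = coeff M k" for k using coeffQ by metis
  then have binM: "coeff M k = 0 \<or> coeff M k = 1" for k
    by (metis mult_cancel_left2 power2_eq_square mult_cancel_right1)
  define c :: "nat \<Rightarrow> bit" where "c k = of_bool (coeff M k = 1)" for k
  have cM: "bit_embed (c k) = coeff M k" for k
    using binM[of k] by (auto simp: c_def)
  have "lfsr_generates V c s"
    unfolding lfsr_generates_def
  proof
    fix i
    have "(\<Sum>k<V. coeff M k * bit_embed (s (i + k))) + bit_embed (s (i + V)) = 0"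
      using annM[of i] leadM by (simp add: lessThan_Suc_atMost[symmetric])
    then have "bit_embed (s (i + V)) = (\<Sum>k<V. coeff M k * bit_embed (s (i + k)))"
      using char2 by (metis add.inverse_unique add_eq_0_iff2 mult_2 mult_zero_left)
    also have "\<dots> = bit_embed (\<Sum>k<V. c k * s (i + k))"
      by (simp only: cM bit_embed_sum[OF char2] bit_embed_mult)
    finally show "s (i + V) = (\<Sum>k<V. c k * s (i + k))"
      by (simp only: bit_embed_inject)
  qed
  then have "linear_complexity s = V"
    unfolding linear_complexity_def V_def using lower by (intro Least_equality) auto
  then show ?thesis unfolding V_def W_def A_def by simp
qed

lemma cong_scale_nat:
  fixes x y m c :: nat
  shows "[x = y] (mod m) \<Longrightarrow> [c * x = c * y] (mod c * m)"
  by (simp add: cong_def flip: mult_mod_right)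

lemma prime_power_factor_unique:
  fixes p u v :: nat
  assumes "p ^ a * u = p ^ a' * v" "\<not> p dvd u" "\<not> p dvd v" "p > 0"
  shows "a = a' \<and> u = v"
proof -
  have *: "\<not> a < a'" if "p ^ a * u = p ^ a' * v" "\<not> p dvd u" for a a' u v
  proof
    assume "a < a'"
    then obtain k where "a' = a + Suc k" using less_imp_Suc_add by auto
    then have "u = p * (p ^ k * v)" using that(1) \<open>p > 0\<close> by (simp add: power_add)
    then show False using that(2) by simp
  qed
  from *[OF assms(1,2)] *[OF assms(1)[symmetric] assms(3)] have "a = a'" by simp
  then show ?thesis using assms(1,4) by simp
qed

subsection \<open>Lifting the support from one level to the next\<close>

text \<open>The witness \<open>i\<close> is the residue of \<open>k - b\<close>. Integers are used
  because \<open>b\<close> may exceed \<open>k\<close>.\<close>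

lemma shifted_half_interval_iff:
  fixes b d k :: nat
  assumes "even d" "d > 0"
  shows "(\<exists>i<d div 2. (i + b) mod d = k mod d) \<longleftrightarrow> 2 * ((int k - int b) mod int d) < int d"
proof
  assume "\<exists>i<d div 2. (i + b) mod d = k mod d"
  then obtain i where i: "i < d div 2" "[i + b = k] (mod d)" by (auto simp: cong_def)
  have "[int i = int k - int b] (mod int d)"
    using i(2) unfolding cong_int_iff[symmetric] cong_iff_dvd_diff by (simp add: algebra_simps)
  then have "(int k - int b) mod int d = int i mod int d" by (simp add: cong_def)
  also have "\<dots> = int i" using i(1) by simp
  finally show "2 * ((int k - int b) mod int d) < int d" using i(1) by linarith
next
  assume a: "2 * ((int k - int b) mod int d) < int d"
  define i where "i = nat ((int k - int b) mod int d)"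
  have i: "int i = (int k - int b) mod int d" using assms unfolding i_def by simp
  have "i < d div 2" using a i assms(1) by (auto elim!: evenE)
  moreover have "[int (i + b) = int k] (mod int d)"
    unfolding of_nat_add i by (simp add: cong_def mod_simps)
  ultimately show "\<exists>i<d div 2. (i + b) mod d = k mod d"
    unfolding cong_int_iff by (auto simp: cong_def)
qed

text \<open>With \<open>p = 2 * h + 1\<close> the bound is \<open>d * h + d / 2\<close>: values
  \<open>t < h\<close> fall below it, values \<open>t > h\<close> above it, and \<open>t = h\<close>
  is decided by \<open>a\<close> alone.\<close>

lemma half_interval_lift:
  fixes a d p :: int
  assumes "odd p" "even d" "0 \<le> a" "a < d" "0 \<le> t" "t < p"
  shows "2 * (a + d * t) < p * d \<longleftrightarrow> t < (p - 1) div 2 + of_bool (2 * a < d)"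
proof -
  obtain h where p: "p = 2 * h + 1" using assms(1) by (auto elim: oddE)
  consider "t < h" | "t = h" | "t > h" by linarith
  then show ?thesis
  proof cases
    case 1
    then have "d * (t + 1) \<le> d * h" using assms by (intro mult_left_mono) auto
    then show ?thesis using 1 assms by (auto simp: p algebra_simps)
  next
    case 2
    then show ?thesis by (auto simp: p algebra_simps)
  next
    case 3
    then have "d * (h + 1) \<le> d * t" using assms by (intro mult_left_mono) auto
    then show ?thesis using 3 assms by (auto simp: p algebra_simps)
  qed
qed

lemma half_interval_antiperiodic:
  fixes y d :: int
  assumes "even d" "d > 0"
  shows "2 * ((y + d div 2) mod d) < d \<longleftrightarrow> \<not> 2 * (y mod d) < d"
proof -
  obtain h where d: "d = 2 * h" using assms(1) by (auto elim: evenE)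
  define m where "m = y mod d"
  have m: "0 \<le> m" "m < d" using assms by (auto simp: m_def)
  have "(y + d div 2) mod d = (m + h) mod d" unfolding m_def d by (simp add: mod_simps)
  also have "\<dots> = (if m < h then m + h else m - h)"
  proof (cases "m < h")
    case False
    have "(m + h) mod d = (m - h + d) mod d" by (simp add: d add.commute)
    also have "\<dots> = m - h" unfolding mod_add_self2 using m False d by (intro mod_pos_pos_trivial) auto
    finally show ?thesis using False by simp
  qed (use m d in simp)
  finally show ?thesis using m d unfolding m_def[symmetric] by auto
qed

text \<open>Reduction inside the predicate makes it periodic on all naturals, so products and lifts
  can be inserted directly.\<close>

definition in_support :: "nat \<Rightarrow> nat \<Rightarrow> nat \<Rightarrow> nat \<Rightarrow> nat \<Rightarrow> nat \<Rightarrow> bool" where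
  "in_support p e g b n x \<longleftrightarrow> x mod p ^ n \<in> support_set p e g n b"

section \<open>Cyclotomic classes in terms of discrete logarithms\<close>

locale cyclotomic_setting =
  fixes p e f g b :: nat
  assumes prime_p: "prime p" and odd_p: "odd p"
    and ef: "p - 1 = e * f" and even_f: "even f"
    and primroot: "\<And>j. j \<ge> 1 \<Longrightarrow> residue_primroot (p ^ j) g"
begin

abbreviation "insup \<equiv> in_support p e g b"

lemma p_gt_2: "p > 2"
  using prime_p odd_p prime_ge_2_nat[of p] by (cases "p = 2") auto

lemma e_pos: "e > 0" and f_pos: "f > 0"
  using p_gt_2 ef by (auto intro!: Nat.gr0I)

lemma ef': "p - Suc 0 = e * f"
  using ef by simp

lemma not_dvd_g: "\<not> p dvd g"
  using primroot[of 1] p_gt_2 by (auto simp: residue_primroot_def coprime_absorb_left)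

lemma not_dvd_g_power: "\<not> p dvd g ^ k"
  using not_dvd_g prime_p prime_dvd_power by blast

lemma cyc_order_eq: "j \<ge> 1 \<Longrightarrow> cyc_order p e j = p ^ (j - 1) * f"
  using e_pos by (simp add: cyc_order_def totient_prime_power[OF prime_p] ef' mult.left_commute)

lemma totient_eq: "j \<ge> 1 \<Longrightarrow> totient (p ^ j) = e * cyc_order p e j"
  by (simp add: cyc_order_eq totient_prime_power[OF prime_p] ef' mult_ac)

lemma cyc_order_pos: "j \<ge> 1 \<Longrightarrow> cyc_order p e j > 0"
  using f_pos p_gt_2 by (simp add: cyc_order_eq)

lemma even_cyc_order: "j \<ge> 1 \<Longrightarrow> even (cyc_order p e j)"
  using even_f by (simp add: cyc_order_eq)

lemma cong_g_power_iff:
  assumes "j \<ge> 1"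
  shows "[g ^ k = g ^ l] (mod p ^ j) \<longleftrightarrow> [k = l] (mod e * cyc_order p e j)"
  using primroot[OF assms] totient_eq[OF assms]
  by (simp add: residue_primroot_def order_divides_expdiff)

lemma g_power_generates:
  assumes "j \<ge> 1" "\<not> p dvd y"
  shows "\<exists>k. [y = g ^ k] (mod p ^ j)"
proof -
  have "p ^ j > 1" using assms(1) p_gt_2 by (intro one_less_power) auto
  have "coprime (p ^ j) y"
    using prime_imp_coprime[OF prime_p assms(2)] by simp
  then have "y mod p ^ j \<in> totatives (p ^ j)"
  proof -
    have *: "coprime (y mod p ^ j) (p ^ j)"
      using \<open>coprime (p ^ j) y\<close> \<open>p ^ j > 1\<close> coprime_mod_left_iff[of "p ^ j" y]
      by (metis coprime_commute not_less_zero)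
    then have "y mod p ^ j \<noteq> 0" using \<open>p ^ j > 1\<close> by (metis coprime_0_left_iff nat_dvd_1_iff_1 less_irrefl)
    moreover have "y mod p ^ j \<le> p ^ j" using \<open>p ^ j > 1\<close> p_gt_2 by (intro less_imp_le mod_less_divisor) auto
    ultimately show ?thesis using * by (simp add: totatives_def)
  qed
  also have "totatives (p ^ j) = (\<lambda>i. g ^ i mod p ^ j) ` {..<totient (p ^ j)}"
    using residue_primroot_is_generator[OF \<open>p ^ j > 1\<close> primroot[OF assms(1)]]
    by (simp add: bij_betw_def)
  finally show ?thesis by (auto simp: cong_def)
qed

text \<open>The definition uses only exponents \<open>i + d * t\<close> with \<open>t < e\<close>.
  Since \<open>g\<close> has order \<open>e * d\<close> modulo \<open>p ^ j\<close>, they represent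
  the whole residue class of exponents modulo \<open>d\<close>.\<close>

lemma mem_cyc_class_iff:
  assumes "j \<ge> 1" "i < cyc_order p e j"
  shows "y \<in> cyc_class p e g j i \<longleftrightarrow> (\<exists>k. k mod cyc_order p e j = i \<and> y = g ^ k mod p ^ j)"
proof
  let ?d = "cyc_order p e j"
  assume "y \<in> cyc_class p e g j i"
  then obtain t where "y = g ^ i * (g ^ (?d * t) mod p ^ j) mod p ^ j"
    by (auto simp: cyc_class_def cyc_class0_def)
  then have "y = g ^ (i + ?d * t) mod p ^ j" by (simp add: power_add mod_simps)
  moreover have "(i + ?d * t) mod ?d = i" using assms(2) by simp
  ultimately show "\<exists>k. k mod ?d = i \<and> y = g ^ k mod p ^ j" by blast
next
  let ?d = "cyc_order p e j"
  assume "\<exists>k. k mod ?d = i \<and> y = g ^ k mod p ^ j"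
  then obtain k where k: "k mod ?d = i" "y = g ^ k mod p ^ j" by blast
  define t where "t = (k div ?d) mod e"
  have "[?d * (k div ?d) + i = ?d * t + i] (mod ?d * e)"
    unfolding t_def by (intro cong_add cong_refl cong_scale_nat) (simp add: cong_def)
  then have "[k = i + ?d * t] (mod e * ?d)"
    using k(1) by (auto simp: mult.commute add.commute)
  then have "[g ^ k = g ^ (i + ?d * t)] (mod p ^ j)"
    using cong_g_power_iff[OF assms(1)] by blast
  then have "y = g ^ i * (g ^ (?d * t) mod p ^ j) mod p ^ j"
    unfolding k(2) by (simp add: cong_def power_add mod_simps)
  moreover have "t < e" using e_pos by (simp add: t_def)
  ultimately show "y \<in> cyc_class p e g j i"
    unfolding cyc_class_def cyc_class0_def by auto
qed

lemma in_support_0 [simp]: "insup n 0"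
  by (simp add: in_support_def support_set_def)

lemma in_support_mod [simp]: "insup n (x mod p ^ n) = insup n x"
  by (simp add: in_support_def)

lemma in_support_cong: "[x = y] (mod p ^ n) \<Longrightarrow> insup n x = insup n y"
  by (simp add: in_support_def cong_def)

text \<open>The power of \<open>p\<close> in a nonzero residue determines the level
  \<open>j\<close>, so only one level of the union matters; there, membership says that the index
  \<open>k\<close> lies in the half window starting at \<open>b\<close>.\<close>

lemma in_support_iff:
  assumes "1 \<le> j" "j \<le> n"
  defines "d \<equiv> cyc_order p e j"
  shows "insup n (p ^ (n - j) * g ^ k) \<longleftrightarrow> 2 * ((int k - int b) mod int d) < int d"
proof -
  have pn: "p ^ (n - j') * p ^ j' = p ^ n" if "j' \<le> n" for j'
    using that by (simp flip: power_add)
  have x: "p ^ (n - j) * g ^ k mod p ^ n = p ^ (n - j) * (g ^ k mod p ^ j)"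
    using pn[OF assms(2)] by (metis mult_mod_right)
  have ndvd: "\<not> p dvd g ^ l mod p ^ j'" if "j' \<ge> 1" for l j'
  proof -
    have "p dvd p ^ j'" using that by (intro dvd_power) auto
    then show ?thesis using not_dvd_g_power[of l] dvd_mod_iff[of p "p ^ j'" "g ^ l"] by simp
  qed
  have nz: "p ^ (n - j) * (g ^ k mod p ^ j) \<noteq> 0"
    using ndvd[OF assms(1), of k] p_gt_2 by (auto intro!: Nat.gr0I)
  have "insup n (p ^ (n - j) * g ^ k) \<longleftrightarrow> (\<exists>j'\<in>{1..n}. \<exists>i<cyc_order p e j' div 2.
      \<exists>y\<in>cyc_class p e g j' ((i + b) mod cyc_order p e j').
        p ^ (n - j) * (g ^ k mod p ^ j) = p ^ (n - j') * y)"
    unfolding in_support_def support_set_def x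
    using nz unfolding UN_iff Un_iff image_iff singleton_iff atLeast0LessThan lessThan_iff Bex_def
    by blast
  also have "\<dots> \<longleftrightarrow> (\<exists>i<d div 2. (i + b) mod d = k mod d)" (is "?l \<longleftrightarrow> ?r")
  proof
    assume ?l
    then obtain j' i y where *: "1 \<le> j'" "j' \<le> n" "i < cyc_order p e j' div 2"
      "y \<in> cyc_class p e g j' ((i + b) mod cyc_order p e j')"
      "p ^ (n - j) * (g ^ k mod p ^ j) = p ^ (n - j') * y"
      by auto
    have "(i + b) mod cyc_order p e j' < cyc_order p e j'"
      using cyc_order_pos[OF *(1)] by simp
    then obtain l where l: "l mod cyc_order p e j' = (i + b) mod cyc_order p e j'"
      "y = g ^ l mod p ^ j'"
      using *(4) mem_cyc_class_iff[OF *(1)] by blast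
    have eq: "n - j = n - j' \<and> g ^ k mod p ^ j = y"
      using prime_power_factor_unique[OF *(5)] ndvd assms(1) *(1) l(2) p_gt_2 by simp
    then have "j' = j" using eq[THEN conjunct1] *(2) assms(2) by linarith
    then have "[g ^ k = g ^ l] (mod p ^ j)" using eq l(2) by (simp add: cong_def)
    then have "[k = l] (mod e * d)" using cong_g_power_iff[OF assms(1)] unfolding d_def by blast
    then have "[k = l] (mod d)" using cong_dvd_modulus_nat by (metis dvd_triv_right)
    then show ?r using l *(3) \<open>j' = j\<close> unfolding d_def cong_def by auto
  next
    assume ?r
    then obtain i where i: "i < d div 2" "(i + b) mod d = k mod d" by blast
    have "k mod d < d" using cyc_order_pos[OF assms(1)] by (simp add: d_def)
    then have "g ^ k mod p ^ j \<in> cyc_class p e g j ((i + b) mod d)"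
      unfolding i(2) using mem_cyc_class_iff[OF assms(1), of "k mod d"] unfolding d_def by blast
    then show ?l using i(1) assms(1,2) unfolding d_def by (intro bexI[of _ j]) auto
  qed
  also have "\<dots> \<longleftrightarrow> 2 * ((int k - int b) mod int d) < int d"
    using even_cyc_order[OF assms(1)] cyc_order_pos[OF assms(1)]
    unfolding d_def by (rule shifted_half_interval_iff)
  finally show ?thesis .
qed

text \<open>Splitting off the full power of \<open>p\<close> leaves a unit, which has a discrete
  logarithm.\<close>

lemma prime_power_times_g_power:
  assumes "\<not> p ^ n dvd x"
  obtains j k where "1 \<le> j" "j \<le> n" "[x = p ^ (n - j) * g ^ k] (mod p ^ n)"
proof -
  have "x \<noteq> 0" using assms by (metis dvd_0_right)
  moreover have "\<not> is_unit p" using p_gt_2 by simp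
  ultimately obtain y where y: "x = p ^ multiplicity p x * y" "\<not> p dvd y"
    by (rule multiplicity_decompose')
  define i where "i = multiplicity p x"
  have "i < n"
  proof (rule ccontr)
    assume "\<not> i < n"
    then have "p ^ n dvd p ^ i" by (simp add: le_imp_power_dvd)
    then show False using assms y(1) unfolding i_def by (metis dvd_mult2)
  qed
  define j where "j = n - i"
  have j: "1 \<le> j" "j \<le> n" "i = n - j" using \<open>i < n\<close> by (auto simp: j_def)
  obtain k where "[y = g ^ k] (mod p ^ j)" using g_power_generates[OF j(1) y(2)] by blast
  then have "[p ^ (n - j) * y = p ^ (n - j) * g ^ k] (mod p ^ (n - j) * p ^ j)"
    by (rule cong_scale_nat)
  moreover have "p ^ (n - j) * p ^ j = p ^ n" using j by (simp flip: power_add)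
  ultimately show ?thesis using that[OF j(1,2)] y(1) j(3) unfolding i_def by simp
qed

text \<open>If \<open>p\<close> divided \<open>w\<close>, the order of \<open>g\<close> modulo
  \<open>p ^ Suc j\<close> would divide \<open>totient (p ^ j)\<close>, although it is
  \<open>p\<close> times as large.\<close>

lemma g_power_totient:
  assumes "j \<ge> 1"
  obtains w where "g ^ totient (p ^ j) = 1 + p ^ j * w" "\<not> p dvd w"
proof -
  have coprime: "coprime g (p ^ j)" for j
    using not_dvd_g prime_p prime_imp_coprime coprime_commute coprime_power_right_iff by metis
  have "[g ^ totient (p ^ j) = 1] (mod p ^ j)"
    using coprime by (intro euler_theorem)
  moreover have "g ^ totient (p ^ j) \<ge> 1"
    using not_dvd_g by (auto intro!: Nat.gr0I simp: Suc_le_eq)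
  ultimately obtain w where w: "g ^ totient (p ^ j) = 1 + p ^ j * w"
    by (metis cong_to_1_nat dvd_def le_add_diff_inverse)
  have "\<not> p dvd w"
  proof
    assume "p dvd w"
    then have "[g ^ totient (p ^ j) = 1 + 0] (mod p ^ Suc j)"
      unfolding w by (intro cong_add cong_refl) (auto simp: cong_0_iff mult.commute)
    then have "ord (p ^ Suc j) g dvd totient (p ^ j)"
      by (simp add: ord_divides')
    then have "totient (p ^ Suc j) dvd totient (p ^ j)"
      using primroot[of "Suc j"] by (simp add: residue_primroot_def)
    then have "totient (p ^ Suc j) \<le> totient (p ^ j)"
      using p_gt_2 by (intro dvd_imp_le) auto
    moreover have "totient (p ^ Suc j) = p * totient (p ^ j)"
      using assms totient_eq[of j] totient_eq[of "Suc j"] cyc_order_eq[of j] cyc_order_eq[of "Suc j"]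
      by (cases j) (simp_all add: mult_ac)
    moreover have "totient (p ^ j) > 0" using p_gt_2 by simp
    ultimately show False using p_gt_2 by simp
  qed
  with w show ?thesis using that by blast
qed

text \<open>The indices of the \<open>p\<close> lifts of \<open>p ^ (n - j) * g ^ k\<close> are equally spaced, at distance
  \<open>d = cyc_order p e j\<close>, modulo \<open>p * d = cyc_order p e (Suc j)\<close>, and the support is a window of
  length \<open>p * d / 2\<close> of indices.\<close>
lemma in_support_lift:
  assumes "\<not> p ^ n dvd x"
  obtains x0 c where "[x0 = x] (mod p ^ n)" "coprime c p"
    "\<And>t. insup (Suc n) (x0 + p ^ n * (c * t)) \<longleftrightarrow> t mod p < (p - 1) div 2 + of_bool (insup n x)"
proof -
  obtain j k where jk: "1 \<le> j" "j \<le> n" "[x = p ^ (n - j) * g ^ k] (mod p ^ n)"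
    using prime_power_times_g_power[OF assms] .
  define d where "d = cyc_order p e j"
  have d: "even d" "d > 0" using even_cyc_order cyc_order_pos jk(1) by (auto simp: d_def)
  have d': "cyc_order p e (Suc j) = p * d"
    unfolding d_def using jk(1) by (cases j) (auto simp: cyc_order_eq)
  have ndvd_e: "\<not> p dvd e"
  proof
    assume "p dvd e"
    then have "p dvd p - 1" unfolding ef by simp
    then show False using p_gt_2 by (auto dest: dvd_imp_le)
  qed
  define a where "a = (int k - int b) mod int d"
  define q where "q = (int k - int b) div int d"
  have a: "0 \<le> a" "a < int d" and kab: "int k - int b = a + int d * q"
    using d by (auto simp: a_def q_def)
  \<comment> \<open>Adding \<open>e * d * v\<close> to the exponent keeps the residue modulo
    \<open>p ^ j\<close> and makes the quotient \<open>q\<close> a multiple of \<open>p\<close>. The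
    listing of lifts then starts at the index \<open>a\<close> of the window.\<close>
  obtain v where "[e * v = nat ((- q) mod int p)] (mod p)"
    using solve_linear_cong[OF prime_p ndvd_e] by blast
  then have "[int (e * v) = (- q) mod int p] (mod int p)"
    using p_gt_2 unfolding cong_int_iff[symmetric] by simp
  then have v: "int p dvd int (e * v) + q"
    by (simp add: cong_iff_dvd_diff[of _ "- q", symmetric, simplified] cong_def mod_simps)
  \<comment> \<open>Exponent steps of \<open>e * d\<close> fix the residue modulo
    \<open>p ^ j\<close>; \<open>u\<close> of them together advance the index by \<open>d\<close>
    modulo \<open>p * d\<close>.\<close>
  obtain u where "[e * u = 1] (mod p)"
    using solve_linear_cong[OF prime_p ndvd_e] by blast
  then have u: "int p dvd int (e * u) - 1"
    unfolding cong_int_iff[symmetric] by (simp add: cong_iff_dvd_diff)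
  have ndvd_u: "\<not> p dvd u"
  proof
    assume "p dvd u"
    then have "int p dvd int (e * u)" by simp
    then have "int p dvd int (e * u) - (int (e * u) - 1)" using u by (rule dvd_diff)
    then show False using p_gt_2 by simp
  qed
  define k0 where "k0 = k + e * d * v"
  obtain w where w: "g ^ (e * d) = 1 + p ^ j * w" "\<not> p dvd w"
    using g_power_totient[OF jk(1)] unfolding totient_eq[OF jk(1)] d_def .
  define x0 where "x0 = p ^ (n - j) * g ^ k0"
  \<comment> \<open>To first order, \<open>(1 + p ^ j * w) ^ (u * t)\<close> is
    \<open>1 + p ^ j * w * u * t\<close>; hence \<open>t\<close> exponent steps add
    \<open>p ^ n * (c * t)\<close> to \<open>x0\<close>.\<close>
  define c where "c = g ^ k0 * (w * u)"
  have pn: "p ^ (n - j) * p ^ j = p ^ n" "p ^ (n - j) * p ^ Suc j = p ^ Suc n"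
    using jk(2) by (simp_all flip: power_add)
  show ?thesis
  proof (rule that[of x0 c])
    have "[k0 = k] (mod e * d)" unfolding k0_def cong_def by (rule mod_mult_self2)
    then have "[g ^ k0 = g ^ k] (mod p ^ j)"
      using cong_g_power_iff[OF jk(1)] unfolding d_def by blast
    then have "[x0 = p ^ (n - j) * g ^ k] (mod p ^ n)"
      unfolding x0_def pn(1)[symmetric] by (rule cong_scale_nat)
    then show "[x0 = x] (mod p ^ n)" using jk(3) cong_sym cong_trans by blast
    have "\<not> p dvd c"
      unfolding c_def using not_dvd_g_power w(2) ndvd_u by (simp add: prime_dvd_mult_iff[OF prime_p])
    then show "coprime c p" using prime_imp_coprime[OF prime_p] coprime_commute[of c p] by simp
    fix t
    have "[g ^ (k0 + e * d * (u * t)) = g ^ k0 * (1 + p ^ j * w * (u * t))] (mod p ^ Suc j)"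
      unfolding power_add power_mult[of g "e * d" "u * t"] w(1)
      by (intro cong_mult cong_refl cong_one_plus_power jk(1))
    then have "[p ^ (n - j) * g ^ (k0 + e * d * (u * t)) =
        p ^ (n - j) * (g ^ k0 * (1 + p ^ j * w * (u * t)))] (mod p ^ (n - j) * p ^ Suc j)"
      by (rule cong_scale_nat)
    also have "p ^ (n - j) * (g ^ k0 * (1 + p ^ j * w * (u * t))) =
        x0 + (p ^ (n - j) * p ^ j) * (c * t)"
      unfolding x0_def c_def by (simp add: algebra_simps)
    finally have "[p ^ (Suc n - Suc j) * g ^ (k0 + e * d * (u * t)) = x0 + p ^ n * (c * t)] (mod p ^ Suc n)"
      unfolding pn by simp
    from in_support_cong[OF this]
    have "insup (Suc n) (x0 + p ^ n * (c * t)) \<longleftrightarrow>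
      2 * ((int (k0 + e * d * (u * t)) - int b) mod int (p * d)) < int (p * d)"
      using in_support_iff[of "Suc j" "Suc n" "k0 + e * d * (u * t)"] jk(2) d' by simp
    also have "(int (k0 + e * d * (u * t)) - int b) mod int (p * d) = a + int d * int (t mod p)"
    proof -
      \<comment> \<open>\<open>d * A\<close> is the excess of the shifted exponent over
        \<open>a + d * (t mod p)\<close>; each summand group of \<open>A\<close> is a multiple of
        \<open>p\<close>.\<close>
      define A where "A = int (e * v) + q + (int (e * u) - 1) * int t + (int t - int (t mod p))"
      have "int p dvd int t - int (t mod p)"
        unfolding of_nat_mod by (simp add: mod_eq_dvd_iff flip: cong_iff_dvd_diff)
      then have "int p dvd A"
        unfolding A_def by (intro dvd_add[OF dvd_add] dvd_mult2 u v)
      then obtain B where B: "A = int p * B" by (elim dvdE)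
      have "int (k0 + e * d * (u * t)) - int b = a + int d * int (t mod p) + int d * A"
        unfolding A_def k0_def using kab by (simp add: algebra_simps)
      also have "\<dots> = a + int d * int (t mod p) + int (p * d) * B"
        unfolding B by simp
      finally have "(int (k0 + e * d * (u * t)) - int b) mod int (p * d) =
          (a + int d * int (t mod p)) mod int (p * d)" by simp
      moreover have "a + int d * int (t mod p) < int (p * d)"
      proof -
        have "t mod p + 1 \<le> p" using p_gt_2 by (simp add: Suc_leI)
        then have "int d * (int (t mod p) + 1) \<le> int d * int p" by (intro mult_left_mono) auto
        then show ?thesis using a by (simp add: algebra_simps)
      qed
      ultimately show ?thesis using a by simp
    qed
    also have "2 * (a + int d * int (t mod p)) < int (p * d) \<longleftrightarrow>
        int (t mod p) < (int p - 1) div 2 + of_bool (2 * a < int d)"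
      using half_interval_lift[of "int p" "int d" a "int (t mod p)"] odd_p d a p_gt_2 by simp
    also have "2 * a < int d \<longleftrightarrow> insup n x"
      using in_support_iff[OF jk(1,2)] in_support_cong[OF jk(3)] unfolding a_def d_def by simp
    also have "(int p - 1) div 2 = int ((p - 1) div 2)" using p_gt_2 by (simp add: zdiv_int)
    finally show "insup (Suc n) (x0 + p ^ n * (c * t)) \<longleftrightarrow>
        t mod p < (p - 1) div 2 + of_bool (insup n x)"
      by (cases "insup n x") auto
  qed
qed

end

subsection \<open>Values at roots of unity\<close>

lemma power_cong_root:
  fixes z :: "'k :: monoid_mult"
  assumes "z ^ N = 1" "[i = j] (mod N)"
  shows "z ^ i = z ^ j"
proof -
  have "z ^ i = z ^ (i mod N)" for i
    using assms(1) by (metis div_mult_mod_eq mult_1 mult.commute power_add power_mult power_one)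
  then show ?thesis using assms(2) unfolding cong_def by metis
qed

lemma power_eq_1_iff_prime_power_dvd:
  fixes z :: "'k :: field"
  assumes "prime p" "z ^ (p ^ Suc n) = 1" "z ^ (p ^ n) \<noteq> 1"
  shows "z ^ k = 1 \<longleftrightarrow> p ^ Suc n dvd k"
proof
  assume zk: "z ^ k = 1"
  show "p ^ Suc n dvd k"
  proof (cases "k = 0")
    case False
    then obtain x y where "k * x = p ^ Suc n * y + gcd k (p ^ Suc n)"
      using bezout_nat by blast
    then have "z ^ (k * x) = z ^ (p ^ Suc n * y + gcd k (p ^ Suc n))" by simp
    then have zg: "z ^ gcd k (p ^ Suc n) = 1"
      unfolding power_add power_mult zk assms(2) by simp
    obtain i where i: "i \<le> Suc n" "gcd k (p ^ Suc n) = p ^ i"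
      using divides_primepow_nat[OF assms(1), of "gcd k (p ^ Suc n)" "Suc n"] by auto
    have "\<not> i \<le> n"
    proof
      assume "i \<le> n"
      then have "p ^ n = p ^ i * p ^ (n - i)" by (simp flip: power_add)
      then have "z ^ (p ^ n) = 1" using zg unfolding i(2) by (simp add: power_mult)
      then show False using assms(3) by simp
    qed
    then have "i = Suc n" using i(1) by simp
    then show ?thesis using i(2) by (metis gcd_dvd1)
  qed simp
next
  assume "p ^ Suc n dvd k"
  then show "z ^ k = 1" using assms(2) by (auto simp: power_mult)
qed

lemma card_complementary_half:
  assumes "finite U" "bij_betw \<pi> U U" "\<And>x. x \<in> U \<Longrightarrow> P (\<pi> x) \<longleftrightarrow> \<not> P x"
  shows "2 * card {x \<in> U. P x} = card U"
proof -
  have "\<pi> ` {x \<in> U. P x} = {x \<in> U. \<not> P x}"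
  proof safe
    fix y assume y: "y \<in> U" "\<not> P y"
    then obtain x where "x \<in> U" "y = \<pi> x" using assms(2) unfolding bij_betw_def by blast
    then show "y \<in> \<pi> ` {x \<in> U. P x}" using y assms(3) by auto
  qed (use assms(2,3) in \<open>auto simp: bij_betw_def\<close>)
  then have "card {x \<in> U. \<not> P x} = card {x \<in> U. P x}"
    using assms(2) card_image[of \<pi> "{x \<in> U. P x}"] unfolding bij_betw_def
    by (metis (lifting) inj_on_subset mem_Collect_eq subsetI)
  moreover have "card U = card {x \<in> U. P x} + card {x \<in> U. \<not> P x}"
    using assms(1) by (subst card_Un_disjoint[symmetric]) (auto intro: arg_cong[where f = card])
  ultimately show ?thesis by simp
qed

lemma bij_betw_mult_mod_prime:
  fixes p h :: nat
  assumes "prime p" "\<not> p dvd h"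
  shows "bij_betw (\<lambda>x. h * x mod p) {1..<p} {1..<p}"
proof -
  have "coprime h p"
    using prime_imp_coprime[OF assms] coprime_commute[of h p] by simp
  have "inj_on (\<lambda>x. h * x mod p) {1..<p}"
  proof (rule inj_onI)
    fix x y assume xy: "x \<in> {1..<p}" "y \<in> {1..<p}" "h * x mod p = h * y mod p"
    then have "[x = y] (mod p)"
      using cong_mult_lcancel_nat[OF \<open>coprime h p\<close>] unfolding cong_def by blast
    then show "x = y" using xy cong_less_modulus_unique_nat by auto
  qed
  moreover have "(\<lambda>x. h * x mod p) ` {1..<p} \<subseteq> {1..<p}"
  proof (rule image_subsetI)
    fix x assume x: "x \<in> {1..<p}"
    then have "\<not> p dvd x" by (auto dest: dvd_imp_le)
    then have "h * x mod p \<noteq> 0"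
      using assms by (simp add: prime_dvd_mult_iff flip: dvd_eq_mod_eq_0)
    then show "h * x mod p \<in> {1..<p}"
      using x by (simp add: Suc_le_eq)
  qed
  ultimately show ?thesis
    using endo_inj_surj[of "{1..<p}" "\<lambda>x. h * x mod p"] by (simp add: bij_betw_def)
qed

lemma sum_of_bool_less:
  fixes h :: "nat \<Rightarrow> 'a :: semiring_1"
  assumes "M \<le> N"
  shows "(\<Sum>t<N. of_bool (t < M) * h t) = (\<Sum>t<M. h t)"
proof -
  have "(\<Sum>t<M. h t) = (\<Sum>t<M. of_bool (t < M) * h t)" by (intro sum.cong) auto
  also have "\<dots> = (\<Sum>t<N. of_bool (t < M) * h t)"
    using assms by (intro sum.mono_neutral_left) auto
  finally show ?thesis by simp
qed

text \<open>If \<open>a < r\<close> is the exponent of \<open>2\<close> in \<open>i\<close>, then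
  \<open>k = 2 ^ (r - 1 - a)\<close> makes \<open>i * k\<close> an odd multiple of
  \<open>2 ^ (r - 1)\<close>.\<close>

lemma multiple_eq_half_power_two:
  fixes i r :: nat
  assumes "\<not> 2 ^ r dvd i"
  shows "\<exists>k q. i * k = 2 ^ r div 2 + 2 ^ r * q"
proof -
  have "i \<noteq> 0" using assms by (metis dvd_0_right)
  then obtain m where m: "i = 2 ^ multiplicity 2 i * m" "\<not> 2 dvd m"
    using multiplicity_decompose'[of i 2] by auto
  define a where "a = multiplicity 2 i"
  obtain q where q: "m = 2 * q + 1" using m(2) by (auto elim: oddE)
  have "a < r"
  proof (rule ccontr)
    assume "\<not> a < r"
    then have "(2::nat) ^ r dvd 2 ^ a" by (simp add: le_imp_power_dvd)
    then show False using assms m(1) unfolding a_def by (metis dvd_mult2)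
  qed
  then obtain c where c: "r = Suc (a + c)" using less_imp_Suc_add by blast
  have "i * 2 ^ c = 2 ^ r div 2 + 2 ^ r * q"
    unfolding m(1)[folded a_def] q c by (simp add: power_add algebra_simps)
  then show ?thesis by blast
qed

context cyclotomic_setting
begin

text \<open>The generating polynomial of one period, evaluated at \<open>z\<close>; \<open>n\<close>
  stays variable so that levels can be compared.\<close>

definition supp_sum :: "nat \<Rightarrow> 'k :: field \<Rightarrow> 'k" where
  "supp_sum n z = (\<Sum>i<p ^ n. of_bool (insup n i) * z ^ i)"

lemma not_dvd_unit: "x \<in> {1..<p} \<Longrightarrow> \<not> p dvd x"
  by (auto dest: dvd_imp_le)

lemma odd_prime_power: "odd (p ^ n)"
  using odd_p by simp

lemma in_support_1_shift:
  assumes "[x = g ^ k] (mod p)"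
  shows "insup 1 (g ^ l * x) \<longleftrightarrow> 2 * ((int k - int b + int l) mod int f) < int f"
proof -
  have "[g ^ l * x = g ^ (k + l)] (mod p ^ 1)"
    using cong_mult[OF cong_refl assms, of "g ^ l"] by (simp add: power_add mult.commute)
  then have "insup 1 (g ^ l * x) = insup 1 (p ^ (1 - 1) * g ^ (k + l))"
    using in_support_cong[of _ _ 1] by simp
  also have "\<dots> \<longleftrightarrow> 2 * ((int (k + l) - int b) mod int f) < int f"
    using in_support_iff[of 1 1 "k + l"] by (simp add: cyc_order_eq)
  finally show ?thesis by (simp add: algebra_simps)
qed

lemma in_support_1_half_shift:
  assumes "\<not> p dvd x"
  shows "insup 1 (g ^ (f div 2) * x) \<longleftrightarrow> \<not> insup 1 x"
proof -
  obtain k where k: "[x = g ^ k] (mod p)"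
    using g_power_generates[of 1 x] assms by auto
  show ?thesis
    using in_support_1_shift[OF k, of "f div 2"] in_support_1_shift[OF k, of 0]
      half_interval_antiperiodic[of "int f" "int k - int b"] even_f f_pos
    by (simp add: zdiv_int)
qed

lemma in_support_1_full_shift:
  assumes "\<not> p dvd x"
  shows "insup 1 (g ^ (f * t) * x) \<longleftrightarrow> insup 1 x"
proof -
  obtain k where k: "[x = g ^ k] (mod p)"
    using g_power_generates[of 1 x] assms by auto
  show ?thesis
    using in_support_1_shift[OF k, of "f * t"] in_support_1_shift[OF k, of 0] by simp
qed

text \<open>The residue \<open>0\<close> has no index, so its lifts need separate treatment. The
  criterion in \<open>in_support_iff\<close> depends on \<open>j\<close> and \<open>k\<close> only,
  which reduces them to level one.\<close>

lemma in_support_Suc_times_power: "insup (Suc n) (p ^ n * t) \<longleftrightarrow> insup 1 t"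
proof (cases "p dvd t")
  case True
  then have "[p ^ n * t = 0] (mod p ^ Suc n)" "[t = 0] (mod p ^ 1)"
    by (auto simp: cong_0_iff mult.commute)
  then show ?thesis using in_support_cong in_support_0 by metis
next
  case False
  then obtain k where k: "[t = g ^ k] (mod p ^ 1)"
    using g_power_generates[of 1] by auto
  then have "[p ^ n * t = p ^ n * g ^ k] (mod p ^ n * p ^ 1)" by (rule cong_scale_nat)
  then have "insup (Suc n) (p ^ n * t) = insup (Suc n) (p ^ (Suc n - 1) * g ^ k)"
    by (intro in_support_cong) (simp add: mult.commute)
  also have "\<dots> = insup 1 (p ^ (1 - 1) * g ^ k)"
    using in_support_iff[of 1 "Suc n" k] in_support_iff[of 1 1 k] by simp
  also have "\<dots> = insup 1 t" using in_support_cong[OF k] by simp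
  finally show ?thesis .
qed

lemma card_in_support_1: "card {t \<in> {1..<p}. insup 1 t} = (p - 1) div 2"
proof -
  have "2 * card {t \<in> {1..<p}. insup 1 t} = card {1..<p}"
  proof (rule card_complementary_half)
    show "bij_betw (\<lambda>x. g ^ (f div 2) * x mod p) {1..<p} {1..<p}"
      by (intro bij_betw_mult_mod_prime prime_p not_dvd_g_power)
    show "insup 1 (g ^ (f div 2) * x mod p) \<longleftrightarrow> \<not> insup 1 x" if "x \<in> {1..<p}" for x
      using in_support_1_half_shift[OF not_dvd_unit[OF that]]
        in_support_mod[of 1 "g ^ (f div 2) * x"] by simp
  qed simp
  then show ?thesis by simp
qed

lemma count_in_support_lifts:
  assumes "x < p ^ n"
  shows "(\<Sum>t<p. of_bool (insup (Suc n) (x + p ^ n * t))) = (p - 1) div 2 + of_bool (insup n x)"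
proof (cases "x = 0")
  case True
  have "(\<Sum>t<p. of_bool (insup (Suc n) (x + p ^ n * t))) = (\<Sum>t<p. of_bool (insup 1 t) :: nat)"
    unfolding True by (simp add: in_support_Suc_times_power del: One_nat_def)
  also have "\<dots> = 1 + card {t \<in> {1..<p}. insup 1 t}"
  proof -
    have "{..<p} = insert 0 {1..<p}" using p_gt_2 by auto
    then show ?thesis
      by (simp only:) (subst sum.insert, auto simp: Int_def conj_commute simp del: One_nat_def)
  qed
  finally show ?thesis
    unfolding card_in_support_1 True by (simp only: in_support_0 of_bool_eq add.commute[of 1])
next
  case False
  then have "\<not> p ^ n dvd x" using assms by (auto dest: dvd_imp_le)
  then obtain x0 c where x0: "[x0 = x] (mod p ^ n)" "coprime c p"
    "\<And>t. insup (Suc n) (x0 + p ^ n * (c * t)) \<longleftrightarrow> t mod p < (p - 1) div 2 + of_bool (insup n x)"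
    using in_support_lift by metis
  have "(\<Sum>t<p. of_bool (insup (Suc n) (x + p ^ n * t)) :: nat) =
      (\<Sum>t<p. of_bool (insup (Suc n) (x0 + p ^ n * (c * t))))"
  proof (rule sum_residue_class_affine[OF _ _ x0(2) _ assms x0(1)])
    show "of_bool (insup (Suc n) (i mod (p ^ n * p))) = (of_bool (insup (Suc n) i) :: nat)" for i
      using in_support_mod[of "Suc n" i] by (simp add: mult.commute)
  qed (use p_gt_2 in auto)
  also have "\<dots> = (\<Sum>t<p. of_bool (t < (p - 1) div 2 + of_bool (insup n x)) * 1)"
    unfolding x0(3) by (intro sum.cong) auto
  also have "\<dots> = (\<Sum>t<(p - 1) div 2 + of_bool (insup n x). 1)"
    using p_gt_2 by (intro sum_of_bool_less) (cases "insup n x", auto)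
  finally show ?thesis by simp
qed

text \<open>All lifts of \<open>x\<close> give the same power of \<open>z\<close>, so only the
  number of them in the support counts.\<close>

lemma supp_sum_Suc:
  fixes z :: "'k :: field"
  assumes "z ^ (p ^ n) = 1"
  shows "supp_sum (Suc n) z = supp_sum n z + of_nat ((p - 1) div 2) * (\<Sum>x<p ^ n. z ^ x)"
proof -
  have z: "z ^ (x + p ^ n * t) = z ^ x" for x t
    using assms by (simp add: power_add power_mult)
  have "supp_sum (Suc n) z =
      (\<Sum>x<p ^ n. \<Sum>t<p. of_bool (insup (Suc n) (x + p ^ n * t)) * z ^ (x + p ^ n * t))"
    unfolding supp_sum_def power_Suc2 using p_gt_2 by (intro sum_lessThan_times) simp
  also have "\<dots> = (\<Sum>x<p ^ n. of_nat (\<Sum>t<p. of_bool (insup (Suc n) (x + p ^ n * t))) * z ^ x)"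
    by (simp only: z of_nat_sum of_nat_of_bool sum_distrib_right)
  also have "\<dots> = (\<Sum>x<p ^ n. of_nat ((p - 1) div 2 + of_bool (insup n x)) * z ^ x)"
    by (intro sum.cong refl arg_cong2[where f = "(*)"] arg_cong[where f = of_nat]
        count_in_support_lifts) simp
  also have "\<dots> = supp_sum n z + of_nat ((p - 1) div 2) * (\<Sum>x<p ^ n. z ^ x)"
    unfolding supp_sum_def sum_distrib_left
    by (simp add: distrib_right sum.distrib)
  finally show ?thesis .
qed

lemma supp_sum_one: "supp_sum n (1 :: 'k :: field) = of_nat ((p ^ n + 1) div 2)"
proof (induction n)
  case 0
  show ?case by (simp add: supp_sum_def)
next
  case (Suc n)
  obtain h where h: "p = 2 * h + 1" using odd_p by (auto elim: oddE)
  obtain m where m: "p ^ n = 2 * m + 1" using odd_prime_power by (metis oddE)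
  have "(p ^ Suc n + 1) div 2 = (p ^ n + 1) div 2 + (p - 1) div 2 * p ^ n"
    unfolding power_Suc2 m unfolding h by (simp add: algebra_simps)
  then show ?case using supp_sum_Suc[of "1 :: 'k" n] Suc by simp
qed

text \<open>Each step above \<open>m\<close> adds a multiple of a complete sum of powers of
  \<open>z \<noteq> 1\<close>, which is zero.\<close>

lemma supp_sum_reduce:
  fixes z :: "'k :: field"
  assumes "(2 :: 'k) = 0" "z ^ (p ^ m) = 1" "z \<noteq> 1" "m \<le> n"
  shows "supp_sum n z = supp_sum m z"
  using assms(4)
proof (induction n rule: dec_induct)
  case (step n)
  then have "p ^ n = p ^ m * p ^ (n - m)" by (simp flip: power_add)
  then have "z ^ (p ^ n) = 1" using assms(2) by (simp add: power_mult)
  then show ?case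
    using supp_sum_Suc[of z n] sum_powers_root_unity[OF assms(1) odd_prime_power, of z n] assms(3)
      step.IH by simp
qed simp

lemma supp_sum_frobenius:
  fixes z :: "'k :: field"
  assumes "(2 :: 'k) = 0"
  shows "supp_sum n (z ^ (2 ^ k)) = supp_sum n z ^ (2 ^ k)"
proof (induction k)
  case (Suc k)
  have *: "supp_sum n (z ^ 2) = supp_sum n z ^ 2" for z :: 'k
    unfolding supp_sum_def power2_sum_char2[OF assms]
    by (intro sum.cong) (auto simp: power_mult_distrib power_mult[symmetric] mult.commute)
  show ?case
    unfolding power_Suc2 power_mult * Suc ..
qed simp

lemma supp_sum_nonzero:
  fixes z :: "'k :: field"
  assumes char2: "(2 :: 'k) = 0" and "[2 ^ (p - 1) \<noteq> 1] (mod p\<^sup>2)" and "n \<ge> 1"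
    and zN: "z ^ (p ^ Suc n) = 1" and "z ^ (p ^ n) \<noteq> 1"
  shows "supp_sum (Suc n) z \<noteq> 0"
proof
  assume zero: "supp_sum (Suc n) z = 0"
  have ord: "z ^ k = 1 \<longleftrightarrow> p ^ Suc n dvd k" for k
    using power_eq_1_iff_prime_power_dvd[OF prime_p assms(4,5)] .
  define N where "N = p ^ Suc n"
  have "N > 0" using p_gt_2 by (simp add: N_def)
  have "[2 ^ (p - 1) = 1] (mod p)"
    using odd_p prime_p p_gt_2 by (intro fermat_theorem) (auto dest: dvd_imp_le)
  moreover have "(2::nat) ^ (p - 1) \<ge> 1" by simp
  \<comment> \<open>The Wieferich hypothesis is exactly that \<open>p\<close> does not divide this
    \<open>w\<close>.\<close>
  ultimately obtain w where w: "(2::nat) ^ (p - 1) = 1 + p * w"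
    by (metis cong_to_1_nat dvd_def le_add_diff_inverse)
  have "\<not> p dvd w"
  proof
    assume "p dvd w"
    then have "[1 + p * w = 1 + 0] (mod p\<^sup>2)"
      by (intro cong_add cong_refl) (auto simp: cong_0_iff power2_eq_square)
    then show False using assms(2) w by simp
  qed
  have conj: "supp_sum (Suc n) (z ^ c) = 0" if c: "[c = 1] (mod p)" for c
  proof -
    obtain k where "[(1 + p * w) ^ k = c] (mod p ^ Suc n)"
      using one_units_generated[OF prime_p odd_p \<open>\<not> p dvd w\<close> c] by blast
    then have "[2 ^ ((p - 1) * k) = c] (mod p ^ Suc n)"
      unfolding w[symmetric] by (simp add: power_mult)
    then have "z ^ c = z ^ (2 ^ ((p - 1) * k))"
      using power_cong_root[OF zN] by metis
    then show ?thesis using zero supp_sum_frobenius[OF char2] by simp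
  qed
  \<comment> \<open>The residue class of \<open>1\<close> modulo \<open>p ^ n\<close> is the one to
    be isolated; \<open>n \<ge> 1\<close> makes it nonzero.\<close>
  have "\<not> p ^ n dvd 1" using assms(3) p_gt_2 by simp
  then obtain x0 c where x0: "coprime c p"
    "\<And>t. insup (Suc n) (x0 + p ^ n * (c * t)) \<longleftrightarrow> t mod p < (p - 1) div 2 + of_bool (insup n 1)"
    using in_support_lift by metis
  \<comment> \<open>A natural number congruent to \<open>-x0\<close> modulo \<open>N\<close>, so
    that \<open>z ^ (i + y)\<close> stands for \<open>z ^ (i - x0)\<close>.\<close>
  define y where "y = (N - 1) * x0"
  have xy: "x0 + y = N * x0" using \<open>N > 0\<close> by (cases N) (simp_all add: y_def)
  have cong_one: "[1 + p * a = 1] (mod p)" for a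
    unfolding cong_def by (rule mod_mult_self2)
  define h where "h i = of_bool (insup (Suc n) i) * of_bool (p ^ n dvd i + y) * z ^ (i + y)" for i
  \<comment> \<open>A twisted sum of the conjugate zeros. Summing over \<open>a\<close> first leaves
    only the indices \<open>i\<close> congruent to \<open>x0\<close> modulo \<open>p ^ n\<close>,
    with weight one because \<open>p ^ n\<close> is odd.\<close>
  have "0 = (\<Sum>a<p ^ n. z ^ ((1 + p * a) * y) * supp_sum (Suc n) (z ^ (1 + p * a)))"
    by (simp only: conj[OF cong_one] mult_zero_right sum.neutral_const)
  also have "\<dots> = (\<Sum>a<p ^ n. \<Sum>i<N. of_bool (insup (Suc n) i) * z ^ (i + y) * (z ^ (p * (i + y))) ^ a)"
    unfolding supp_sum_def N_def sum_distrib_left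
  proof (intro sum.cong refl)
    fix a i
    have "z ^ ((1 + p * a) * y) * (z ^ (1 + p * a)) ^ i = z ^ (i + y) * (z ^ (p * (i + y))) ^ a"
      unfolding power_mult[symmetric] power_add[symmetric]
      by (rule arg_cong[where f = "\<lambda>k. z ^ k"]) (simp add: algebra_simps)
    then show "z ^ ((1 + p * a) * y) * (of_bool (insup (Suc n) i) * (z ^ (1 + p * a)) ^ i) =
        of_bool (insup (Suc n) i) * z ^ (i + y) * (z ^ (p * (i + y))) ^ a"
      by (metis mult.left_commute mult.assoc)
  qed
  also have "\<dots> = (\<Sum>i<N. of_bool (insup (Suc n) i) * z ^ (i + y) * (\<Sum>a<p ^ n. (z ^ (p * (i + y))) ^ a))"
    by (subst sum.swap) (simp add: sum_distrib_left)
  also have "\<dots> = (\<Sum>i<N. h i)"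
  proof (rule sum.cong[OF refl])
    fix i
    have "(z ^ (p * (i + y))) ^ (p ^ n) = 1"
      unfolding power_mult[symmetric] ord by simp
    from sum_powers_root_unity[OF char2 odd_prime_power this]
    have "(\<Sum>a<p ^ n. (z ^ (p * (i + y))) ^ a) = of_bool (p ^ n dvd i + y)"
      unfolding ord using p_gt_2 by simp
    then show "of_bool (insup (Suc n) i) * z ^ (i + y) * (\<Sum>a<p ^ n. (z ^ (p * (i + y))) ^ a) = h i"
      unfolding h_def by simp
  qed
  also have "\<dots> = (\<Sum>x<p ^ n. \<Sum>t<p. h (x + p ^ n * t))"
    unfolding N_def power_Suc2 using p_gt_2 by (intro sum_lessThan_times) simp
  also have "\<dots> = (\<Sum>x<p ^ n. if x = x0 mod p ^ n then (\<Sum>t<p. h (x + p ^ n * t)) else 0)"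
  proof (rule sum.cong[OF refl])
    fix x assume x: "x \<in> {..<p ^ n}"
    have "h (x + p ^ n * t) = 0" if "x \<noteq> x0 mod p ^ n" for t
    proof -
      have "\<not> p ^ n dvd x + p ^ n * t + y"
      proof
        assume "p ^ n dvd x + p ^ n * t + y"
        then have "[(x + y) + p ^ n * t = 0] (mod p ^ n)" by (simp add: cong_0_iff add_ac)
        then have "[x + y = 0] (mod p ^ n)" by (simp add: cong_def)
        moreover have "[x0 + y = 0] (mod p ^ n)"
          unfolding xy by (simp add: cong_0_iff N_def)
        ultimately have "[x = x0] (mod p ^ n)"
          using cong_add_rcancel_nat cong_sym cong_trans by metis
        then show False using x that by (simp add: cong_def)
      qed
      then show ?thesis by (simp add: h_def)
    qed
    then show "(\<Sum>t<p. h (x + p ^ n * t)) =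
        (if x = x0 mod p ^ n then (\<Sum>t<p. h (x + p ^ n * t)) else 0)"
      by simp
  qed
  also have "\<dots> = (\<Sum>t<p. h (x0 mod p ^ n + p ^ n * t))"
    using p_gt_2 by simp
  also have "\<dots> = (\<Sum>t<p. h (x0 + p ^ n * (c * t)))"
  proof (rule sum_residue_class_affine[OF _ _ x0(1)])
    fix i
    have "[i mod (p ^ n * p) + y = i + y] (mod p ^ Suc n)"
      by (simp add: cong_def mod_simps mult.commute)
    then have "z ^ (i mod (p ^ n * p) + y) = z ^ (i + y)"
      "p ^ n dvd i mod (p ^ n * p) + y \<longleftrightarrow> p ^ n dvd i + y"
      using power_cong_root[OF zN] cong_dvd_iff cong_dvd_modulus_nat[of _ _ "p ^ Suc n" "p ^ n"]
      by (blast, metis dvd_triv_right power_Suc)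
    then show "h (i mod (p ^ n * p)) = h i"
      using in_support_mod[of "Suc n" i] unfolding h_def by (simp add: mult.commute)
  qed (use p_gt_2 in \<open>auto simp: cong_def\<close>)
  also have "\<dots> = (\<Sum>t<p. of_bool (t < (p - 1) div 2 + of_bool (insup n 1)) * (z ^ (p ^ n * c)) ^ t)"
  proof (rule sum.cong[OF refl])
    fix t assume t: "t \<in> {..<p}"
    have e: "x0 + p ^ n * (c * t) + y = N * x0 + p ^ n * c * t"
      using xy by (simp add: algebra_simps)
    have "p ^ n dvd N * x0 + p ^ n * c * t"
      by (intro dvd_add) (simp_all add: N_def)
    moreover have "z ^ (N * x0 + p ^ n * c * t) = (z ^ (p ^ n * c)) ^ t"
      using zN unfolding N_def power_add power_mult by simp
    ultimately show "h (x0 + p ^ n * (c * t)) =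
        of_bool (t < (p - 1) div 2 + of_bool (insup n 1)) * (z ^ (p ^ n * c)) ^ t"
      using t unfolding h_def x0(2) e by simp
  qed
  also have "\<dots> = (\<Sum>t<(p - 1) div 2 + of_bool (insup n 1). (z ^ (p ^ n * c)) ^ t)"
    using p_gt_2 by (intro sum_of_bool_less) (cases "insup n 1", auto)
  finally have geom: "(\<Sum>t<(p - 1) div 2 + of_bool (insup n 1). (z ^ (p ^ n * c)) ^ t) = 0"
    by simp
  define M where "M = (p - 1) div 2 + of_bool (insup n 1)"
  \<comment> \<open>\<open>M\<close> is \<open>(p - 1) / 2\<close> or \<open>(p + 1) / 2\<close>. A
    geometric sum of \<open>M\<close> powers of \<open>z ^ (p ^ n * c)\<close>, which has order
    \<open>p\<close>, vanishes only if \<open>p\<close> divides \<open>M\<close>.\<close>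
  have M: "0 < M" "M < p"
    using p_gt_2 by (cases "insup n 1"; auto simp: M_def)+
  have "((z ^ (p ^ n * c)) ^ M - 1) = (z ^ (p ^ n * c) - 1) * (\<Sum>t<M. (z ^ (p ^ n * c)) ^ t)"
    by (rule power_diff_1_eq)
  then have "z ^ (p ^ n * c * M) = 1"
    using geom unfolding M_def[symmetric] by (simp add: power_mult)
  then have "p dvd c * M"
    unfolding ord using p_gt_2 by (simp add: mult.assoc)
  then have "p dvd M"
    using x0(1) by (simp add: coprime_commute coprime_dvd_mult_right_iff)
  then show False using M by (auto dest: dvd_imp_le)
qed

section \<open>Roots of unity of order \<open>p\<close>\<close>

lemma supp_sum_1_eq:
  "supp_sum 1 z = 1 + (\<Sum>x\<in>{1..<p}. of_bool (insup 1 x) * z ^ x)"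
proof -
  have "{..<p ^ 1} = insert 0 {1..<p}" using p_gt_2 by auto
  then show ?thesis unfolding supp_sum_def by (simp del: One_nat_def)
qed

lemma sum_units_mult:
  fixes F :: "nat \<Rightarrow> 'a :: comm_monoid_add"
  assumes "\<not> p dvd h"
  shows "(\<Sum>x\<in>{1..<p}. F (h * x mod p)) = (\<Sum>x\<in>{1..<p}. F x)"
  using sum.reindex_bij_betw[OF bij_betw_mult_mod_prime[OF prime_p assms]] .

text \<open>Substituting \<open>h * x\<close> for \<open>x\<close> turns the support into its
  complement among the nonzero residues. All nonzero powers of \<open>z\<close> sum to
  \<open>-1\<close>, and the index \<open>0\<close> contributes \<open>1\<close> on both
  sides.\<close>

lemma supp_sum_1_half_shift:
  fixes z :: "'k :: field"
  assumes "z ^ p = 1" "z \<noteq> 1"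
  shows "supp_sum 1 (z ^ (g ^ (f div 2))) = 1 - supp_sum 1 z"
proof -
  let ?h = "g ^ (f div 2)" and ?U = "{1..<p}"
  have zm: "z ^ (x mod p) = z ^ x" for x
    using power_cong_root[OF assms(1)] by (metis cong_mod_right cong_refl)
  have "(\<Sum>x\<in>?U. of_bool (insup 1 x) * (z ^ ?h) ^ x) =
      (\<Sum>x\<in>?U. (1 - of_bool (insup 1 (?h * x mod p))) * z ^ (?h * x mod p))"
    by (intro sum.cong refl)
       (use in_support_1_half_shift[OF not_dvd_unit] in_support_mod[of 1] in
         \<open>simp add: zm power_mult del: One_nat_def\<close>)
  also have "\<dots> = (\<Sum>x\<in>?U. (1 - of_bool (insup 1 x)) * z ^ x)"
    using sum_units_mult[OF not_dvd_g_power, of "\<lambda>x. (1 - of_bool (insup 1 x)) * z ^ x"] .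
  also have "\<dots> = (\<Sum>x\<in>?U. z ^ x) - (\<Sum>x\<in>?U. of_bool (insup 1 x) * z ^ x)"
    by (simp add: left_diff_distrib sum_subtractf)
  also have "(\<Sum>x\<in>?U. z ^ x) = -1"
  proof -
    have "{..<p} = insert 0 ?U" using p_gt_2 by auto
    then have "(\<Sum>x<p. z ^ x) = 1 + (\<Sum>x\<in>?U. z ^ x)" by simp
    moreover have "(\<Sum>x<p. z ^ x) = 0" using geometric_sum[OF assms(2), of p] assms(1) by simp
    ultimately show ?thesis by (simp add: add_eq_0_iff)
  qed
  finally show ?thesis unfolding supp_sum_1_eq by simp
qed

lemma supp_sum_1_full_shift:
  fixes z :: "'k :: field"
  assumes "z ^ p = 1"
  shows "supp_sum 1 (z ^ (g ^ (f * t))) = supp_sum 1 z"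
proof -
  let ?h = "g ^ (f * t)" and ?U = "{1..<p}"
  have zm: "z ^ (x mod p) = z ^ x" for x
    using power_cong_root[OF assms(1)] by (metis cong_mod_right cong_refl)
  have "(\<Sum>x\<in>?U. of_bool (insup 1 x) * (z ^ ?h) ^ x) =
      (\<Sum>x\<in>?U. of_bool (insup 1 (?h * x mod p)) * z ^ (?h * x mod p))"
    by (intro sum.cong refl)
       (use in_support_1_full_shift[OF not_dvd_unit] in_support_mod[of 1] in
         \<open>simp add: zm power_mult del: One_nat_def\<close>)
  also have "\<dots> = (\<Sum>x\<in>?U. of_bool (insup 1 x) * z ^ x)"
    using sum_units_mult[OF not_dvd_g_power, of "\<lambda>x. of_bool (insup 1 x) * z ^ x"] .
  finally show ?thesis unfolding supp_sum_1_eq by simp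
qed

lemma card_supp_sum_1_zeros:
  fixes \<zeta> :: "'k :: field"
  assumes char2: "(2 :: 'k) = 0" and "f = 2 ^ r" and "\<zeta> ^ p = 1" "\<zeta> \<noteq> 1"
  shows "card {u \<in> {1..<p}. supp_sum 1 (\<zeta> ^ u) = 0} =
    (if 2 mod p \<in> cyc_class0 p e g 1 then (p - 1) div 2 else 0)"
proof -
  have root: "(\<zeta> ^ u) ^ p = 1" for u
    using assms(3) by (metis mult.commute power_mult power_one)
  have nontriv: "\<zeta> ^ u \<noteq> 1" if "u \<in> {1..<p}" for u
    using power_eq_1_iff_prime_power_dvd[OF prime_p, of \<zeta> 0 u] assms(3,4) not_dvd_unit[OF that]
    by simp
  have cyc1: "cyc_order p e 1 = f" by (simp add: cyc_order_eq)
  show ?thesis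
  proof (cases "2 mod p \<in> cyc_class0 p e g 1")
    case True
    then obtain t where t: "[2 = g ^ (f * t)] (mod p)"
      unfolding cyc_class0_def cyc1 by (auto simp: cong_def)
    have zero_one: "supp_sum 1 z = 0 \<or> supp_sum 1 z = 1" if "z ^ p = 1" for z :: 'k
    proof -
      have "supp_sum 1 z ^ 2 = supp_sum 1 (z ^ 2)"
        using supp_sum_frobenius[OF char2, of 1 z 1] by simp
      also have "z ^ 2 = z ^ (g ^ (f * t))"
        using power_cong_root[OF that t] .
      also have "supp_sum 1 \<dots> = supp_sum 1 z"
        using supp_sum_1_full_shift[OF that] .
      finally show ?thesis by (simp add: power2_eq_square)
    qed
    have "2 * card {u \<in> {1..<p}. supp_sum 1 (\<zeta> ^ u) = 0} = card {1..<p}"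
    proof (rule card_complementary_half)
      show "bij_betw (\<lambda>x. g ^ (f div 2) * x mod p) {1..<p} {1..<p}"
        by (intro bij_betw_mult_mod_prime prime_p not_dvd_g_power)
      fix u assume u: "u \<in> {1..<p}"
      have "\<zeta> ^ (g ^ (f div 2) * u mod p) = (\<zeta> ^ u) ^ (g ^ (f div 2))"
        using power_cong_root[OF assms(3)]
        by (metis cong_mod_left cong_refl mult.commute power_mult)
      then have "supp_sum 1 (\<zeta> ^ (g ^ (f div 2) * u mod p)) = 1 - supp_sum 1 (\<zeta> ^ u)"
        using supp_sum_1_half_shift[OF root nontriv[OF u]] by simp
      then show "supp_sum 1 (\<zeta> ^ (g ^ (f div 2) * u mod p)) = 0 \<longleftrightarrow> \<not> supp_sum 1 (\<zeta> ^ u) = 0"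
        using zero_one[OF root, of u] by auto
    qed simp
    then show ?thesis using True by simp
  next
    case False
    have "\<not> p dvd 2" using p_gt_2 by (auto dest: dvd_imp_le)
    then obtain i where i: "[2 = g ^ i] (mod p)"
      using g_power_generates[of 1 2] by auto
    have "\<not> f dvd i"
    proof
      assume "f dvd i"
      then obtain t where t: "i = f * t" by blast
      have "[f * (t mod e) = f * t] (mod f * e)"
        by (rule cong_scale_nat) (simp add: cong_def)
      then have "[g ^ (f * (t mod e)) = g ^ (f * t)] (mod p ^ 1)"
        unfolding cong_g_power_iff[OF order_refl] cyc1 by (simp add: mult.commute)
      then have "2 mod p = g ^ (f * (t mod e)) mod p"
        using i t by (simp add: cong_def)
      then show False using False e_pos unfolding cyc_class0_def cyc1 by auto
    qed
    \<comment> \<open>Thus \<open>2 ^ k\<close> is \<open>g ^ (f div 2)\<close> times a power of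
      \<open>g ^ f\<close>. Frobenius would carry a zero \<open>z\<close> to the value
      \<open>1 - 0\<close> at \<open>z ^ (2 ^ k)\<close>.\<close>
    then obtain k q where kq: "i * k = f div 2 + f * q"
      using multiple_eq_half_power_two unfolding assms(2) by blast
    have "[2 ^ k = g ^ (f div 2) * g ^ (f * q)] (mod p)"
      using cong_pow[OF i, of k] by (simp add: kq flip: power_mult power_add)
    then have two: "z ^ (2 ^ k) = (z ^ (g ^ (f div 2))) ^ (g ^ (f * q))" if "z ^ p = 1" for z :: 'k
      using power_cong_root[OF that] by (metis power_mult)
    have "supp_sum 1 (\<zeta> ^ u) \<noteq> 0" if u: "u \<in> {1..<p}" for u
    proof
      assume zero: "supp_sum 1 (\<zeta> ^ u) = 0"
      have "supp_sum 1 (\<zeta> ^ u) ^ (2 ^ k) = supp_sum 1 ((\<zeta> ^ u) ^ (2 ^ k))"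
        using supp_sum_frobenius[OF char2, of 1 "\<zeta> ^ u" k] by simp
      also have "\<dots> = supp_sum 1 ((\<zeta> ^ u) ^ (g ^ (f div 2)))"
        unfolding two[OF root]
        by (rule supp_sum_1_full_shift) (metis root power_mult mult.commute)
      also have "\<dots> = 1 - supp_sum 1 (\<zeta> ^ u)"
        using supp_sum_1_half_shift[OF root nontriv[OF u]] .
      finally show False using zero by (simp add: zero_power)
    qed
    then have "{u \<in> {1..<p}. supp_sum 1 (\<zeta> ^ u) = 0} = {}" by blast
    then show ?thesis using False by (simp only: card.empty if_False)
  qed
qed

end

section \<open>Existence of the root of unity and the total count of zeros\<close>

text \<open>A zero of \<open>1 + x + ... + x ^ (p - 1)\<close> is not \<open>1\<close>, since that
  value is the odd number \<open>p\<close>, equal to \<open>1\<close> in characteristic two. A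
  \<open>p ^ n\<close>-th root of it has the required order.\<close>

lemma primitive_prime_power_root_exists:
  assumes "(2 :: 'k :: alg_closed_field) = 0" "prime p" "odd p"
  shows "\<exists>\<gamma> :: 'k. \<gamma> ^ (p ^ Suc n) = 1 \<and> \<gamma> ^ (p ^ n) \<noteq> 1"
proof -
  have p: "p \<ge> 2" using assms(2) by (rule prime_ge_2_nat)
  obtain \<zeta> :: 'k where "(\<Sum>k\<le>p - 1. 1 * \<zeta> ^ k) = 0"
    using alg_closed[of "p - 1" "\<lambda>_. 1 :: 'k"] p by auto
  moreover have "{..p - 1} = {..<p}" using p by auto
  ultimately have \<zeta>: "(\<Sum>k<p. \<zeta> ^ k) = 0" by simp
  have "\<zeta> ^ p - 1 = (\<zeta> - 1) * (\<Sum>k<p. \<zeta> ^ k)" by (rule power_diff_1_eq)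
  then have "\<zeta> ^ p = 1" using \<zeta> by simp
  moreover have "\<zeta> \<noteq> 1"
    using \<zeta> of_nat_odd_char2[OF assms(1,3)] by auto
  moreover obtain \<gamma> where "\<gamma> ^ (p ^ n) = \<zeta>"
    using nth_root_exists[of "p ^ n" \<zeta>] p by auto
  ultimately show ?thesis by (metis power_Suc2 power_mult)
qed

context cyclotomic_setting
begin

text \<open>The exponents \<open>a\<close> are sorted by their power of \<open>p\<close>:
  \<open>a = 0\<close> gives the root \<open>1\<close>, exact divisibility by \<open>p ^ n\<close>
  gives order \<open>p\<close>, and smaller powers give orders at least \<open>p\<^sup>2\<close>,
  where no zero occurs.\<close>

lemma card_supp_sum_nonzero:
  fixes \<gamma> :: "'k :: field"
  assumes char2: "(2 :: 'k) = 0" and "f = 2 ^ r" and wieferich: "[2 ^ (p - 1) \<noteq> 1] (mod p\<^sup>2)"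
    and \<gamma>N: "\<gamma> ^ (p ^ Suc n) = 1" and \<gamma>: "\<gamma> ^ (p ^ n) \<noteq> 1"
  shows "int (card {a. a < p ^ Suc n \<and> supp_sum (Suc n) (\<gamma> ^ a) \<noteq> 0}) =
    int (p ^ Suc n) - (if 2 mod p \<in> cyc_class0 p e g 1 then int ((p - 1) div 2) else 0) -
      even_indicator ((p ^ Suc n + 1) div 2)"
proof -
  let ?N = "p ^ Suc n" and ?S = "supp_sum (Suc n)"
  define \<zeta> where "\<zeta> = \<gamma> ^ (p ^ n)"
  define Z where "Z = {a. a < ?N \<and> ?S (\<gamma> ^ a) = 0}"
  define Z1 where "Z1 = {u \<in> {1..<p}. supp_sum 1 (\<zeta> ^ u) = 0}"
  define Z0 :: "nat set" where "Z0 = (if even ((?N + 1) div 2) then {0} else {})"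
  have \<zeta>: "\<zeta> ^ p = 1" "\<zeta> \<noteq> 1"
    using \<gamma>N \<gamma> by (simp_all add: \<zeta>_def power_mult[symmetric] mult.commute)
  have ord: "\<gamma> ^ k = 1 \<longleftrightarrow> ?N dvd k" for k
    using power_eq_1_iff_prime_power_dvd[OF prime_p \<gamma>N \<gamma>] .
  have S1: "?S (1 :: 'k) = 0 \<longleftrightarrow> even ((?N + 1) div 2)"
  proof (cases "even ((?N + 1) div 2)")
    case True
    then obtain m where "(?N + 1) div 2 = 2 * m" by blast
    then show ?thesis using True char2 unfolding supp_sum_one by simp
  next
    case False
    then show ?thesis using of_nat_odd_char2[OF char2 False] unfolding supp_sum_one by simp
  qed
  have S\<zeta>: "?S (\<gamma> ^ (p ^ n * u)) = supp_sum 1 (\<zeta> ^ u)" if u: "u \<in> {1..<p}" for u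
  proof -
    have "\<gamma> ^ (p ^ n * u) \<noteq> 1"
      unfolding ord power_Suc2 using not_dvd_unit[OF u] p_gt_2 by simp
    moreover have "(\<gamma> ^ (p ^ n * u)) ^ (p ^ 1) = 1"
      unfolding power_mult[symmetric] ord by simp
    ultimately have "?S (\<gamma> ^ (p ^ n * u)) = supp_sum 1 (\<gamma> ^ (p ^ n * u))"
      by (intro supp_sum_reduce[OF char2]) auto
    then show ?thesis by (simp add: \<zeta>_def power_mult)
  qed
  have "Z = Z0 \<union> (\<lambda>u. p ^ n * u) ` Z1"
  proof (intro equalityI subsetI)
    fix a assume "a \<in> Z"
    then have a: "a < ?N" "?S (\<gamma> ^ a) = 0" by (auto simp: Z_def)
    show "a \<in> Z0 \<union> (\<lambda>u. p ^ n * u) ` Z1"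
    proof (cases "a = 0")
      case True
      then show ?thesis using a(2) S1 by (simp add: Z0_def)
    next
      case False
      have "\<not> is_unit p" using p_gt_2 by simp
      with False obtain u where u: "a = p ^ multiplicity p a * u" "\<not> p dvd u"
        by (rule multiplicity_decompose')
      define i where "i = multiplicity p a"
      have ai: "a = p ^ i * u" using u(1) by (simp add: i_def)
      have "u > 0" using u(2) by (auto intro!: Nat.gr0I)
      have "p ^ i < p ^ Suc n"
      proof (rule le_less_trans)
        show "p ^ i \<le> a" unfolding ai using \<open>u > 0\<close> by simp
      qed (rule a(1))
      then have "i < Suc n" using p_gt_2 power_less_imp_less_exp[of p i "Suc n"] by simp
      then have "i \<le> n" by simp
      have "i = n"
      proof (rule ccontr)
        assume "i \<noteq> n"
        \<comment> \<open>With this \<open>m\<close> the order of \<open>\<gamma> ^ a\<close> is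
          \<open>p ^ (m + 2)\<close>, as \<open>supp_sum_nonzero\<close> demands.\<close>
        then obtain m where m: "n = i + Suc m" using \<open>i \<le> n\<close>
          by (metis le_neq_implies_less less_imp_Suc_add add_Suc_right)
        let ?z = "\<gamma> ^ a"
        have "?z ^ (p ^ Suc (Suc m)) = 1"
          unfolding power_mult[symmetric] ord ai m by (simp add: power_add)
        moreover have nz: "?z ^ (p ^ Suc m) \<noteq> 1"
        proof
          assume "?z ^ (p ^ Suc m) = 1"
          then have "p ^ n * p dvd p ^ n * u"
            unfolding power_mult[symmetric] ord ai m by (simp add: power_add mult_ac)
          then show False using u(2) p_gt_2 by simp
        qed
        moreover from nz have "?z \<noteq> 1" by auto
        ultimately have "?S ?z = supp_sum (Suc (Suc m)) ?z"
          using m by (intro supp_sum_reduce[OF char2]) auto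
        moreover have "supp_sum (Suc (Suc m)) ?z \<noteq> 0"
          using \<open>?z ^ (p ^ Suc (Suc m)) = 1\<close> nz
          by (intro supp_sum_nonzero[OF char2 wieferich]) auto
        ultimately show False using a(2) by simp
      qed
      then have au: "a = p ^ n * u" using ai by simp
      then have "u \<in> {1..<p}" using a(1) \<open>u > 0\<close> by (simp add: mult.commute[of p])
      then show ?thesis using a(2) S\<zeta> au by (auto simp: Z1_def)
    qed
  next
    fix a assume "a \<in> Z0 \<union> (\<lambda>u. p ^ n * u) ` Z1"
    then show "a \<in> Z"
    proof
      assume "a \<in> Z0"
      then have "a = 0" "even ((?N + 1) div 2)" by (auto simp: Z0_def split: if_splits)
      then show ?thesis using S1 p_gt_2 by (simp add: Z_def)
    next
      assume "a \<in> (\<lambda>u. p ^ n * u) ` Z1"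
      then obtain u where u: "a = p ^ n * u" "u \<in> {1..<p}" "supp_sum 1 (\<zeta> ^ u) = 0"
        by (auto simp: Z1_def)
      have "p ^ n * u < p ^ n * p" using u(2) by simp
      then show ?thesis using u S\<zeta> by (simp add: Z_def mult.commute)
    qed
  qed
  moreover have "Z0 \<inter> (\<lambda>u. p ^ n * u) ` Z1 = {}"
    using p_gt_2 by (auto simp: Z0_def Z1_def)
  moreover have "card ((\<lambda>u. p ^ n * u) ` Z1) = card Z1"
    using p_gt_2 by (intro card_image inj_onI) simp
  moreover have "finite Z0" "finite Z1" by (auto simp: Z0_def Z1_def)
  ultimately have cardZ: "card Z = card Z0 + card Z1"
    by (simp add: card_Un_disjoint)
  have "card Z1 = (if 2 mod p \<in> cyc_class0 p e g 1 then (p - 1) div 2 else 0)"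
    unfolding Z1_def using card_supp_sum_1_zeros[OF char2 assms(2) \<zeta>] .
  moreover have "int (card Z0) = even_indicator ((?N + 1) div 2)"
    by (simp add: Z0_def even_indicator_def)
  moreover have "int (card {a. a < ?N \<and> ?S (\<gamma> ^ a) \<noteq> 0}) = int ?N - int (card Z)"
  proof -
    have "{a. a < ?N \<and> ?S (\<gamma> ^ a) \<noteq> 0} = {..<?N} - Z" by (auto simp: Z_def)
    moreover have "Z \<subseteq> {..<?N}" by (auto simp: Z_def)
    ultimately have "card {a. a < ?N \<and> ?S (\<gamma> ^ a) \<noteq> 0} = ?N - card Z"
      by (simp only: card_Diff_subset[OF finite_subset[OF _ finite_lessThan]] card_lessThan)
    moreover have "card Z \<le> ?N"
      using card_mono[OF _ \<open>Z \<subseteq> {..<?N}\<close>] by simp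
    ultimately show ?thesis by (simp only: of_nat_diff)
  qed
  ultimately show ?thesis unfolding cardZ by simp
qed

end

text \<open>If \<open>k\<close> is the order modulo \<open>p\<close>, then
  \<open>g ^ (k * p)\<close> is \<open>1\<close> modulo \<open>p\<^sup>2\<close>, so
  \<open>p * (p - 1)\<close> divides \<open>k * p\<close> and \<open>k = p - 1\<close>. Being
  primitive modulo \<open>p\<close> with \<open>g ^ (p - 1)\<close> not \<open>1\<close> modulo
  \<open>p\<^sup>2\<close>, \<open>g\<close> lifts to all powers.\<close>

lemma residue_primroot_prime_powers:
  assumes "prime p" "odd p" "residue_primroot (p\<^sup>2) g" "j \<ge> 1"
  shows "residue_primroot (p ^ j) g"
proof -
  have p: "p > 1" using assms(1) by (rule prime_gt_1_nat)
  have cop: "coprime (p\<^sup>2) g" and ord2: "ord (p\<^sup>2) g = p * (p - 1)"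
    using assms(1,3) totient_prime_power[of p 2] by (auto simp: residue_primroot_def)
  have cop1: "coprime p g" using cop by simp
  define k where "k = ord p g"
  have "[g ^ k = 1] (mod p)" unfolding k_def by (rule ord)
  moreover have "g ^ k \<ge> 1" using cop1 p by (auto intro!: Nat.gr0I simp: Suc_le_eq)
  ultimately obtain w where w: "g ^ k = 1 + p ^ 1 * w"
    by (metis cong_to_1_nat dvd_def le_add_diff_inverse power_one_right)
  have "[g ^ (k * p) = 1 + p ^ 1 * w * p] (mod p ^ Suc 1)"
    unfolding power_mult w by (rule cong_one_plus_power) simp
  also have "[1 + p ^ 1 * w * p = 1 + 0] (mod p ^ Suc 1)"
    by (intro cong_add cong_refl) (simp add: cong_0_iff)
  finally have "[g ^ (k * p) = 1] (mod p\<^sup>2)" by (simp add: numeral_2_eq_2)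
  then have "p * (p - 1) dvd k * p" unfolding ord_divides ord2 .
  then have "p - 1 dvd k" using p by (simp add: mult.commute[of k])
  moreover have "k dvd p - 1"
    using order_divides_totient[OF cop1] totient_prime[OF assms(1)] by (simp add: k_def)
  ultimately have "k = p - 1" by (rule dvd_antisym[rotated])
  then have primroot: "residue_primroot p g"
    using cop1 p totient_prime[OF assms(1)] by (simp add: residue_primroot_def k_def)
  have "[g ^ (p - 1) \<noteq> 1] (mod p\<^sup>2)"
    unfolding ord_divides ord2 using p by (auto dest: dvd_imp_le)
  with residue_primroot_prime_lift_iff[OF assms(1,2) primroot]
  have "\<forall>k>0. residue_primroot (p ^ k) g" by (rule iffD2)
  then show ?thesis using assms(4) by simp
qed

theorem theorem7:
  fixes p e f r g n b :: nat
  assumes "prime p" and "odd p"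
    and "e > 0" and "e dvd p - 1"
    and "f = (p - 1) div e" and "f = 2 ^ r" and "r \<ge> 1"
    and "residue_primroot (p\<^sup>2) g"
    and "n \<ge> 1"
    and "b \<le> p ^ (n - 1) * f - 1"
    and "[2 ^ (p - 1) \<noteq> 1] (mod p\<^sup>2)"
  shows "int (linear_complexity (cyc_seq p e g n b)) =
    (if 2 mod p \<in> cyc_class0 p e g 1
     then int (p ^ n) - int ((p - 1) div 2) - even_indicator ((p ^ n + 1) div 2)
     else int (p ^ n) - even_indicator ((p ^ n + 1) div 2))"
proof -
  interpret cyclotomic_setting p e f g b
  proof
    show "p - 1 = e * f" using assms(4,5) by simp
    show "even f" unfolding \<open>f = 2 ^ r\<close> using \<open>r \<ge> 1\<close> by simp
    show "residue_primroot (p ^ j) g" if "j \<ge> 1" for j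
      using residue_primroot_prime_powers[OF assms(1,2,8) that] .
  qed (fact assms)+
  obtain m where n: "n = Suc m" using \<open>n \<ge> 1\<close> by (cases n) auto
  have char2: "(2 :: bit alg_closure) = 0"
    using to_ac_numeral[where ?'a = bit, of "num.Bit0 num.One"] by simp
  obtain \<gamma> :: "bit alg_closure" where \<gamma>: "\<gamma> ^ (p ^ Suc m) = 1" "\<gamma> ^ (p ^ m) \<noteq> 1"
    using primitive_prime_power_root_exists[OF char2 \<open>prime p\<close> \<open>odd p\<close>] by blast
  have "linear_complexity (cyc_seq p e g n b) =
      card {a. a < p ^ n \<and> (\<Sum>i<p ^ n. bit_embed (cyc_seq p e g n b i) * \<gamma> ^ (a * i)) \<noteq> 0}"
  proof (rule linear_complexity_eq_card_dft[OF char2 odd_prime_power])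
    show "\<gamma> ^ k = 1 \<longleftrightarrow> p ^ n dvd k" for k
      using power_eq_1_iff_prime_power_dvd[OF \<open>prime p\<close> \<gamma>] unfolding n .
  qed (simp add: cyc_seq_def)
  moreover have "(\<Sum>i<p ^ n. bit_embed (cyc_seq p e g n b i) * \<gamma> ^ (a * i)) = supp_sum n (\<gamma> ^ a)" for a
    unfolding supp_sum_def in_support_def cyc_seq_def by (simp add: power_mult)
  ultimately show ?thesis
    using card_supp_sum_nonzero[OF char2 \<open>f = 2 ^ r\<close> assms(11) \<gamma>] by (simp add: n)
qed

end
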